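(* Let $n_1\asymp\cdots\asymp n_d$ and let $k\ge1$ be a fixed integer, $k\le\min_in_i-1$. Let $S$ be a mesh grid with $s:=|S|$ elements and let $\tilde S$ be the corresponding enlarged mesh grid. Then the inverse scaling factor satisfies $$\tilde\gamma(\tilde S)=\max_{(j_1,\dots,j_d)\in\times_{i\in[d]}[k+1:n_i]}\frac{\|\mathrm A_{\tilde S}\,\tilde\phi^k_{j_1,\dots,j_d}\|_2}{\sqrt n}=\mathcal O\!\left(s^{-\frac{2k-1}{2H(d)}}\right),\qquad H(d)=\sum_{i=1}^d\frac1i .$$
   Context: Notation: $[i:j]=\{i,\dots,j\}$, $[j]=[1:j]$, $n=n_1\cdots n_d$, $\|\cdot\|_2$ is the Frobenius norm on $\mathbb{R}^{n_1\times\cdots\times n_d}$. One-dimensional dictionary (for length $N$; used with $N=n_i$ for coordinate $i$): $\phi^1_j=\{1_{\{j'\ge j\}}\}_{j'\in[N]}$; for $k\ge2$, $\phi^k_j=\phi^j_j$ if $j\in[k-1]$ and $\phi^k_j=\sum_{l\ge j}\phi^{k-1}_l/N$ if $j\in[k:N]$. With $\mathrm A_{W}$ the orthogonal projection onto the orthogonal complement of $\mathrm{span}(W)$, set $\tilde\phi^k_j=\mathrm A_{\{\phi^l_l,\,l\in[k]\}}\phi^k_j$ for $j\in[k+1:N]$. In $d$ dimensions, for $(j_1,\dots,j_d)\in\times_i[k+1:n_i]$, $\tilde\phi^k_{j_1,\dots,j_d}=\tilde\phi^k_{j_1}\times\cdots\times\tilde\phi^k_{j_d}$ is the outer product (entry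 at $(j_1',\dots,j_d')$ equal to $\prod_i\tilde\phi^k_{j_i}(j_i')$). $\mathrm A_{\tilde S}$ is the orthogonal projection onto the orthogonal complement of $\mathrm{span}\{\tilde\phi^k_{j_1,\dots,j_d}:(j_1,\dots,j_d)\in\tilde S\}$. The inverse scaling factor is (a bound on) the maximal normalized length of the antiprojections $\mathrm A_{\tilde S}\tilde\phi^k_{j_1,\dots,j_d}$. Mesh grids: let $\delta\in\mathbb N$. For each coordinate $i\in[d]$ and $l\in[d]$ let $Z_i(l)$ be a set of $\delta^{d/l}$ equispaced indices in $[n_i]$, such that $Z_i(1)\supseteq Z_i(2)\supseteq\cdots\supseteq Z_i(d)$ (if exact equispacing is impossible, indices are only required to be approximately equispaced, i.e. all consecutive distances are asymptotically of the same order). Let $\tilde Z_i(l)=\bigcup_{h=0}^{k-1}(Z_i(l)+h)$ and $$\mathcal S=\{(l_1,\dots,l_d)\in[d]^d:\ |\{i\in[d]:l_i\le z\}|\le z\ \ \forall z\in[d]\}.$$ The mesh grid is $S=\bigcup_{(l_1,\dots,l_d)\in\mathcal S}\times_{i\in[d]}Z_i(l_i)$ and the enlarged mesh grid is $\tilde S=\bigcup_{(l_1,\dots,l_d)\in\mathcal S}\times_{i\in[d]}\tilde Z_i(l_i)$, both understood as subsets of $\times_i[k+1:n_i]$. One has $s\asymp|\tilde S|\asymp\delta^{dH(d)}$. Implied constants may depend on $k$, $d$, and the constants in the approximate equispacing and in $n_1\asymp\cdots\asymp n_d$. *)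

theory Defs
  imports "HOL-Analysis.Analysis" "HOL-Library.Function_Algebras"
begin

text \<open>
  The sizes \<open>n\<^sub>1, \<dots>, n\<^sub>d\<close> vary inside the statement, so vectors in \<open>\<real>\<^sup>N\<close> and tensors in
  \<open>\<real>\<^bsup>n\<^sub>1 \<times> \<dots> \<times> n\<^sub>d\<^esup>\<close> are represented by real functions that vanish outside the finite index set
  \<open>{1..N}\<close>, respectively \<open>grid_box d n\<close>. The norm is \<open>L2_set f I = sqrt (\<Sum>x\<in>I. (f x)\<^sup>2)\<close>.
\<close>

interpretation fun_space: vector_space "\<lambda>(c::real) (f :: 'a \<Rightarrow> real) x. c * f x"
  by unfold_locales (auto simp: fun_eq_iff algebra_simps)

definition ip :: "'a set \<Rightarrow> ('a \<Rightarrow> real) \<Rightarrow> ('a \<Rightarrow> real) \<Rightarrow> real" where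
  "ip I f g = (\<Sum>x\<in>I. f x * g x)"

text \<open>
  Orthogonal projection onto the orthogonal complement of \<open>span W\<close> in \<open>\<real>\<^sup>I\<close>:
  \<open>f = (f - antiproj I W f) + antiproj I W f\<close> is the decomposition of \<open>f\<close> into an element of
  \<open>span W\<close> and an element of its orthogonal complement; see \<open>antiproj_well_defined\<close>.
\<close>

definition antiproj :: "'a set \<Rightarrow> ('a \<Rightarrow> real) set \<Rightarrow> ('a \<Rightarrow> real) \<Rightarrow> 'a \<Rightarrow> real" where
  "antiproj I W f =
    (THE g. f - g \<in> fun_space.span W \<and> (\<forall>w \<in> fun_space.span W. ip I g w = 0))"

text \<open>\<open>phi N k j\<close> is \<open>\<phi>\<^sup>k\<^sub>j\<close> for length \<open>N\<close>; the case \<open>k = 0\<close> is a dummy.\<close>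

fun phi :: "nat \<Rightarrow> nat \<Rightarrow> nat \<Rightarrow> nat \<Rightarrow> real" where
  "phi N 0 j = (\<lambda>x. 0)"
| "phi N (Suc 0) j = (\<lambda>x. if x \<in> {1..N} \<and> j \<le> x then 1 else 0)"
| "phi N (Suc (Suc k)) j =
    (if j \<le> Suc k then phi N j j else (\<lambda>x. (\<Sum>l\<in>{j..N}. phi N (Suc k) l x) / real N))"

definition phit :: "nat \<Rightarrow> nat \<Rightarrow> nat \<Rightarrow> nat \<Rightarrow> real" where
  "phit N k j = antiproj {1..N} ((\<lambda>l. phi N l l) ` {1..k}) (phi N k j)"

definition grid_box :: "nat \<Rightarrow> (nat \<Rightarrow> nat) \<Rightarrow> (nat \<Rightarrow> nat) set" where
  "grid_box d n = (\<Pi>\<^sub>E i\<in>{1..d}. {1..n i})"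

definition knot_box :: "nat \<Rightarrow> (nat \<Rightarrow> nat) \<Rightarrow> nat \<Rightarrow> (nat \<Rightarrow> nat) set" where
  "knot_box d n k = (\<Pi>\<^sub>E i\<in>{1..d}. {k+1..n i})"

definition phit_tensor ::
  "nat \<Rightarrow> (nat \<Rightarrow> nat) \<Rightarrow> nat \<Rightarrow> (nat \<Rightarrow> nat) \<Rightarrow> (nat \<Rightarrow> nat) \<Rightarrow> real" where
  "phit_tensor d n k j =
    (\<lambda>x. if x \<in> grid_box d n then \<Prod>i\<in>{1..d}. phit (n i) k (j i) (x i) else 0)"

definition inv_scaling ::
  "nat \<Rightarrow> (nat \<Rightarrow> nat) \<Rightarrow> nat \<Rightarrow> (nat \<Rightarrow> nat) set \<Rightarrow> real" where
  "inv_scaling d n k T =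
    Max ((\<lambda>j. L2_set (antiproj (grid_box d n) (phit_tensor d n k ` T) (phit_tensor d n k j))
                 (grid_box d n) / sqrt (real (\<Prod>i\<in>{1..d}. n i))) ` knot_box d n k)"

definition comparable_sizes :: "real \<Rightarrow> nat \<Rightarrow> (nat \<Rightarrow> nat) \<Rightarrow> bool" where
  "comparable_sizes c d n \<longleftrightarrow> (\<forall>i\<in>{1..d}. \<forall>i'\<in>{1..d}. real (n i) \<le> c * real (n i'))"

text \<open>
  All distances between consecutive elements of \<open>A\<close> are of the order \<open>N / |A|\<close> up to the constant
  \<open>c\<close>. The last two conditions say that \<open>A\<close> spreads over all of \<open>{1..N}\<close>: the stretches before
  the first and after the last element are not of larger order.
\<close>

definition approx_equispaced :: "real \<Rightarrow> nat \<Rightarrow> nat set \<Rightarrow> bool" where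
  "approx_equispaced c N A \<longleftrightarrow>
     A \<noteq> {} \<and> A \<subseteq> {1..N} \<and>
     (\<forall>a\<in>A. \<forall>b\<in>A. a < b \<and> A \<inter> {a<..<b} = {} \<longrightarrow>
        real N \<le> c * real (card A) * (real b - real a) \<and>
        (real b - real a) * real (card A) \<le> c * real N) \<and>
     (real (Min A) - 1) * real (card A) \<le> c * real N \<and>
     (real N - real (Max A)) * real (card A) \<le> c * real N"

text \<open>
  \<open>Z i l\<close> is \<open>Z\<^sub>i(l)\<close>. The number \<open>\<delta>\<^bsup>d/l\<^esup>\<close> need not be an integer, so the cardinality is required
  to be \<open>\<delta>\<^bsup>d/l\<^esup>\<close> rounded up or down (hence equal to it if it is an integer).
\<close>

definition mesh_indices ::
  "real \<Rightarrow> nat \<Rightarrow> (nat \<Rightarrow> nat) \<Rightarrow> nat \<Rightarrow> (nat \<Rightarrow> nat \<Rightarrow> nat set) \<Rightarrow> bool" where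
  "mesh_indices c d n \<delta> Z \<longleftrightarrow>
     (\<forall>i\<in>{1..d}. \<forall>l\<in>{1..d}.
        approx_equispaced c (n i) (Z i l) \<and>
        \<bar>real (card (Z i l)) - real \<delta> powr (real d / real l)\<bar> < 1) \<and>
     (\<forall>i\<in>{1..d}. \<forall>l\<in>{1..d}. \<forall>l'\<in>{1..d}. l \<le> l' \<longrightarrow> Z i l' \<subseteq> Z i l)"

definition enlarge :: "nat \<Rightarrow> (nat \<Rightarrow> nat \<Rightarrow> nat set) \<Rightarrow> nat \<Rightarrow> nat \<Rightarrow> nat set" where
  "enlarge k Z i l = (\<Union>h\<in>{0..<k}. (\<lambda>z. z + h) ` Z i l)"

definition levels :: "nat \<Rightarrow> (nat \<Rightarrow> nat) set" where
  "levels d = {l \<in> {1..d} \<rightarrow>\<^sub>E {1..d}. \<forall>z\<in>{1..d}. card {i\<in>{1..d}. l i \<le> z} \<le> z}"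

text \<open>Used for \<open>Z\<close> (mesh grid) and for \<open>enlarge k Z\<close> (enlarged mesh grid).\<close>

definition mesh_grid ::
  "nat \<Rightarrow> (nat \<Rightarrow> nat) \<Rightarrow> nat \<Rightarrow> (nat \<Rightarrow> nat \<Rightarrow> nat set) \<Rightarrow> (nat \<Rightarrow> nat) set" where
  "mesh_grid d n k Z = (\<Union>l\<in>levels d. \<Pi>\<^sub>E i\<in>{1..d}. Z i (l i)) \<inter> knot_box d n k"

lemma phi_vanishes: "x \<notin> {1..N} \<Longrightarrow> phi N k j x = 0"
proof (induction N k j rule: phi.induct)
  case (3 N k j)
  show ?case
  proof (cases "j \<le> Suc k")
    case True
    with 3 show ?thesis by simp
  next
    case False
    with 3 have "(\<Sum>l\<in>{j..N}. phi N (Suc k) l x) = 0"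
      by (intro sum.neutral) blast
    with False show ?thesis by (simp del: phi.simps add: phi.simps(3))
  qed
qed auto

lemma span_vanishes:
  assumes "\<And>w x. w \<in> W \<Longrightarrow> x \<notin> I \<Longrightarrow> w x = 0" "h \<in> fun_space.span W" "x \<notin> I"
  shows "h x = 0"
  using assms(2) by (induction rule: fun_space.span_induct_alt) (auto simp: assms)

lemma ip_add_right: "ip I f (g + h) = ip I f g + ip I f h"
  and ip_scale_right: "ip I f (\<lambda>x. c * g x) = c * ip I f g"
  and ip_diff_left: "ip I (f - g) h = ip I f h - ip I g h"
  and ip_scale_left: "ip I (\<lambda>x. c * f x) g = c * ip I f g"
  and ip_commute: "ip I f g = ip I g f"
  by (auto simp: ip_def algebra_simps sum.distrib sum_subtractf sum_distrib_left)

lemma ip_span: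
  assumes "\<And>w. w \<in> W \<Longrightarrow> ip I g w = 0" "h \<in> fun_space.span W"
  shows "ip I g h = 0"
  using assms(2)
proof (induction rule: fun_space.span_induct_alt)
  case base
  show ?case by (simp add: ip_def)
next
  case (step c w h)
  then show ?case by (simp only: ip_add_right ip_scale_right assms(1) mult_zero_right add_0_right)
qed

lemma antiproj_exists:
  assumes "finite I" "finite W"
  shows "\<exists>g. f - g \<in> fun_space.span W \<and> (\<forall>w\<in>fun_space.span W. ip I g w = 0)"
  using assms(2)
proof (induction arbitrary: f rule: finite_induct)
  case empty
  show ?case by (rule exI[of _ f]) (simp add: ip_def flip: zero_fun_def)
next
  case (insert v W)
  obtain g where g: "f - g \<in> fun_space.span W" "\<forall>w\<in>fun_space.span W. ip I g w = 0"
    using insert.IH by blast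
  obtain u where u: "v - u \<in> fun_space.span W" "\<forall>w\<in>fun_space.span W. ip I u w = 0"
    using insert.IH by blast
  define c where "c = ip I g u / ip I u u"
  define g' where "g' = g - (\<lambda>x. c * u x)"
  have mono: "fun_space.span W \<subseteq> fun_space.span (insert v W)"
    by (rule fun_space.span_mono) auto
  have "u = v - (v - u)" by simp
  then have "u \<in> fun_space.span (insert v W)"
    using fun_space.span_diff[OF fun_space.span_base[of v "insert v W"], of "v - u"] u(1) mono
    by auto
  then have "(f - g) + (\<lambda>x. c * u x) \<in> fun_space.span (insert v W)"
    using g(1) mono by (intro fun_space.span_add fun_space.span_scale) auto
  moreover have "(f - g) + (\<lambda>x. c * u x) = f - g'"
    by (auto simp: g'_def fun_eq_iff)
  ultimately have 1: "f - g' \<in> fun_space.span (insert v W)" by simp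
  have W: "ip I g' w = 0" if "w \<in> fun_space.span W" for w
    using that g(2) u(2) by (simp add: g'_def ip_diff_left ip_scale_left)
  have "ip I g' u = 0"
  proof (cases "ip I u u = 0")
    case True
    then have "\<forall>x\<in>I. u x = 0"
      using \<open>finite I\<close> by (simp add: ip_def sum_nonneg_eq_0_iff)
    then show ?thesis by (simp add: ip_def)
  next
    case False
    then have "c * ip I u u = ip I g u" by (simp add: c_def)
    then show ?thesis by (simp add: g'_def ip_diff_left ip_scale_left)
  qed
  then have "ip I g' v = 0"
    using W[OF u(1)] ip_add_right[of I g' "v - u" u] by simp
  then have "ip I g' w = 0" if "w \<in> insert v W" for w
    using that W fun_space.span_base[of w W] by blast
  then have "\<forall>w\<in>fun_space.span (insert v W). ip I g' w = 0"
    using ip_span[of "insert v W" I g'] by blast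
  with 1 show ?case by blast
qed

lemma antiproj_well_defined:
  assumes "finite I" "finite W" "\<And>w x. w \<in> W \<Longrightarrow> x \<notin> I \<Longrightarrow> w x = 0"
  shows "\<exists>!g. f - g \<in> fun_space.span W \<and> (\<forall>w\<in>fun_space.span W. ip I g w = 0)"
proof (rule ex_ex1I)
  show "\<exists>g. f - g \<in> fun_space.span W \<and> (\<forall>w\<in>fun_space.span W. ip I g w = 0)"
    using antiproj_exists[OF assms(1,2)] .
next
  fix g h
  assume g: "f - g \<in> fun_space.span W \<and> (\<forall>w\<in>fun_space.span W. ip I g w = 0)"
    and h: "f - h \<in> fun_space.span W \<and> (\<forall>w\<in>fun_space.span W. ip I h w = 0)"
  have "(f - h) - (f - g) \<in> fun_space.span W"
    using g h by (blast intro: fun_space.span_diff)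
  then have s: "g - h \<in> fun_space.span W" by (simp add: algebra_simps)
  then have "ip I (g - h) (g - h) = 0"
    using g h by (simp add: ip_diff_left)
  then have "\<forall>x\<in>I. g x = h x"
    using \<open>finite I\<close> by (simp add: ip_def sum_nonneg_eq_0_iff)
  moreover have "g x = h x" if "x \<notin> I" for x
    using span_vanishes[of W I "g - h" x] assms(3) s that by simp
  ultimately show "g = h" by (auto simp: fun_eq_iff)
qed

end

theory Submission
  imports Defs
begin

text \<open>
  Up to scaling, \<open>\<phi>\<^sup>k\<^sub>j\<close> is the truncation to \<open>x \<ge> j\<close> of the polynomial
  \<open>x \<mapsto> (x - j + k - 1) gchoose (k - 1)\<close>, and \<open>\<phi>\<^sup>1\<^sub>1, \<dots>, \<phi>\<^sup>k\<^sub>k\<close> span the polynomials of degree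
  less than \<open>k\<close>. The polynomials belonging to \<open>k\<close> consecutive knots \<open>z, \<dots>, z + k - 1\<close> generate all
  those belonging to knots \<open>j \<ge> z\<close>, so a combination of these \<open>k\<close> atoms agrees with \<open>\<phi>\<^sup>k\<^sub>j\<close>
  outside \<open>[z, j)\<close>, with squared error at most \<open>N ((j - z) / N)\<^bsup>2k - 1\<^esup>\<close>. Hence in coordinate \<open>i\<close>
  the level-\<open>l\<close> knots approximate every atom with normalized error of order \<open>\<eta>\<^bsup>1/l\<^esup>\<close>, where
  \<open>\<eta> = \<delta>\<^bsup>-d(2k - 1)/2\<^esup>\<close>.

  Telescope each factor as \<open>\<phi> = \<Delta>\<^sub>0 + \<dots> + \<Delta>\<^sub>d\<close> with \<open>\<Delta>\<^sub>l = P\<^sub>l - P\<^sub>l\<^sub>+\<^sub>1\<close>, \<open>P\<^sub>0 = id\<close>, \<open>P\<^sub>d\<^sub>+\<^sub>1 = 0\<close>, and expand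
  the tensor product. The terms with \<open>(l\<^sub>1, \<dots>, l\<^sub>d)\<close> in \<open>levels d\<close> lie in the span of the enlarged
  mesh grid. Any other term has, for some \<open>z < d\<close>, at least \<open>z + 1\<close> indices \<open>l\<^sub>i \<le> z\<close>, each
  contributing a factor of order at most \<open>\<eta>\<^bsup>1/(z + 1)\<^esup>\<close>, so it is of order \<open>\<eta>\<close>. Finally
  \<open>s\<close> is at most of order \<open>\<delta>\<^bsup>dH(d)\<^esup>\<close>.
\<close>

subsection \<open>Truncated powers\<close>

text \<open>In both definitions \<open>k\<close> is the degree, so they belong to \<open>\<phi>\<^bsup>k + 1\<^esup>\<close>.\<close>

definition trunc_binom :: "nat \<Rightarrow> nat \<Rightarrow> nat \<Rightarrow> real" where
  "trunc_binom k j x = (if j \<le> x then real ((x - j + k) choose k) else 0)"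

definition poly_binom :: "nat \<Rightarrow> nat \<Rightarrow> nat \<Rightarrow> real" where
  "poly_binom k j x = (real x - real j + real k) gchoose k"

text \<open>The recursion sums over the knots, and the hockey-stick identity turns such a sum into a
  binomial of the next degree. The hypothesis keeps the recursion out of the branch that returns
  \<open>phi N j j\<close>.\<close>

lemma phi_eq_trunc_binom:
  assumes "Suc k \<le> j"
  shows "phi N (Suc k) j x = (if x \<in> {1..N} then trunc_binom k j x / real N ^ k else 0)"
  using assms
proof (induction k arbitrary: j)
  case 0
  then show ?case by (simp add: trunc_binom_def)
next
  case (Suc k)
  show ?case
  proof (cases "x \<in> {1..N}")
    case False
    then show ?thesis by (metis phi_vanishes)
  next
    case True
    have "phi N (Suc (Suc k)) j x = (\<Sum>l\<in>{j..N}. phi N (Suc k) l x) / real N"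
      using Suc.prems by simp
    also have "(\<Sum>l\<in>{j..N}. phi N (Suc k) l x) = (\<Sum>l\<in>{j..N}. trunc_binom k l x / real N ^ k)"
      using True Suc.prems by (intro sum.cong refl) (simp add: Suc.IH del: phi.simps)
    also have "\<dots> = (\<Sum>l\<in>{j..N}. trunc_binom k l x) / real N ^ k"
      by (simp add: sum_divide_distrib)
    also have "(\<Sum>l\<in>{j..N}. trunc_binom k l x) = trunc_binom (Suc k) j x"
    proof (cases "j \<le> x")
      case False
      then show ?thesis by (auto simp: trunc_binom_def)
    next
      case le: True
      have "(\<Sum>l\<in>{j..N}. trunc_binom k l x) = (\<Sum>l\<in>{j..x}. trunc_binom k l x)"
        using True by (intro sum.mono_neutral_right) (auto simp: trunc_binom_def)
      also have "\<dots> = (\<Sum>m\<le>x - j. real ((k + m) choose k))"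
        by (rule sum.reindex_bij_witness[of _ "\<lambda>m. x - m" "\<lambda>l. x - l"])
          (use le in \<open>auto simp: trunc_binom_def add.commute\<close>)
      also have "\<dots> = real (\<Sum>m\<le>x - j. (k + m) choose k)" by simp
      also have "(\<Sum>m\<le>x - j. (k + m) choose k) = (x - j + Suc k) choose Suc k"
        using choose_rising_sum(1)[of k "x - j"] by (simp add: add_ac)
      finally show ?thesis using le by (simp add: trunc_binom_def)
    qed
    finally show ?thesis using True by simp
  qed
qed

text \<open>Pascal's rule, read as a difference in the knot: moving the knot by one changes the
  polynomial by one of lower degree.\<close>

lemma poly_binom_rec: "poly_binom k j = poly_binom (Suc k) j - poly_binom (Suc k) (Suc j)"
proof
  fix x
  show "poly_binom k j x = (poly_binom (Suc k) j - poly_binom (Suc k) (Suc j)) x"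
    using gbinomial_Suc_Suc[of "real x - real j + real k" k]
    by (simp add: poly_binom_def algebra_simps)
qed

text \<open>The polynomial vanishes at the \<open>k\<close> points just left of \<open>j\<close>.
  Hence truncated powers with knots in \<open>{z..z + k}\<close> all coincide with their polynomials
  from \<open>z\<close> on.\<close>

lemma trunc_binom_eq_poly_binom:
  assumes "j \<le> x + k"
  shows "trunc_binom k j x = poly_binom k j x"
proof -
  have "poly_binom k j x = real (x + k - j) gchoose k"
    using assms by (simp add: poly_binom_def of_nat_diff algebra_simps)
  also have "\<dots> = real ((x + k - j) choose k)" by (simp add: binomial_gbinomial)
  finally show ?thesis using assms by (auto simp: trunc_binom_def binomial_eq_0)
qed

lemma abs_poly_binom_le:
  assumes "x < j"
  shows "\<bar>poly_binom k j x\<bar> \<le> real (j - x) ^ k"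
proof -
  have "poly_binom k j x = (-1) ^ k * (real (j - x - 1) gchoose k)"
    unfolding poly_binom_def using assms
    by (subst gbinomial_negated_upper) (simp add: of_nat_diff algebra_simps)
  also have "real (j - x - 1) gchoose k = real ((j - x - 1) choose k)"
    by (simp add: binomial_gbinomial)
  finally have eq: "\<bar>poly_binom k j x\<bar> = real ((j - x - 1) choose k)"
    by (simp add: abs_mult power_abs)
  have "(j - x - 1) choose k \<le> (j - x) ^ k"
  proof (cases "k \<le> j - x - 1")
    case True
    then have "(j - x - 1) choose k \<le> (j - x - 1) ^ k" by (rule binomial_le_pow)
    also have "\<dots> \<le> (j - x) ^ k" by (rule power_mono) auto
    finally show ?thesis .
  qed (simp add: binomial_eq_0)
  then show ?thesis unfolding eq by (metis of_nat_le_iff of_nat_power)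
qed

section \<open>Spans of shifted binomial polynomials\<close>

text \<open>Induction on the degree, then on \<open>j\<close>: differences of neighbouring
  generators are consecutive polynomials of one degree less, and these generate every increment in
  \<open>j\<close>.\<close>

lemma poly_binom_in_span_consecutive:
  assumes "z \<le> j"
  shows "poly_binom k j \<in> fun_space.span (poly_binom k ` {z..z + k})"
  using assms
proof (induction k arbitrary: j)
  case 0
  have "poly_binom 0 j = poly_binom 0 z" by (simp add: poly_binom_def fun_eq_iff)
  then show ?case by (simp add: fun_space.span_base)
next
  case (Suc k)
  let ?V = "fun_space.span (poly_binom (Suc k) ` {z..z + Suc k})"
  have "poly_binom k ` {z..z + k} \<subseteq> ?V"
  proof (intro image_subsetI)
    fix i assume "i \<in> {z..z + k}"
    then show "poly_binom k i \<in> ?V"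
      by (subst poly_binom_rec) (intro fun_space.span_diff fun_space.span_base imageI; simp)
  qed
  then have sub: "fun_space.span (poly_binom k ` {z..z + k}) \<subseteq> ?V"
    by (rule fun_space.span_minimal) (rule fun_space.subspace_span)
  show ?case
    using Suc.prems
  proof (induction j rule: dec_induct)
    case base
    show ?case by (rule fun_space.span_base) auto
  next
    case (step j)
    have "poly_binom (Suc k) (Suc j) = poly_binom (Suc k) j - poly_binom k j"
      by (simp add: poly_binom_rec[of k j])
    then show ?case
      using fun_space.span_diff[OF step.IH subsetD[OF sub Suc.IH[OF step.hyps(1)]]] by (simp only:)
  qed
qed

text \<open>The generators belong to the atoms \<open>phi N (Suc l) (Suc l)\<close>, one in each
  degree. Knot \<open>Suc k\<close> is the generator of top degree, and further moves of the knot
  involve lower degrees only.\<close>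

lemma poly_binom_in_span_diagonal:
  assumes "Suc k \<le> j"
  shows "poly_binom k j \<in> fun_space.span ((\<lambda>l. poly_binom l (Suc l)) ` {0..k})"
  using assms
proof (induction k arbitrary: j)
  case 0
  have "poly_binom 0 j = poly_binom 0 (Suc 0)" by (simp add: poly_binom_def fun_eq_iff)
  then show ?case by (simp add: fun_space.span_base)
next
  case (Suc k)
  have sub: "fun_space.span ((\<lambda>l. poly_binom l (Suc l)) ` {0..k})
    \<subseteq> fun_space.span ((\<lambda>l. poly_binom l (Suc l)) ` {0..Suc k})"
    by (intro fun_space.span_mono image_mono) auto
  show ?case
    using Suc.prems
  proof (induction j rule: dec_induct)
    case base
    show ?case by (rule fun_space.span_base) auto
  next
    case (step j)
    have "poly_binom (Suc k) (Suc j) = poly_binom (Suc k) j - poly_binom k j"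
      by (simp add: poly_binom_rec[of k j])
    then show ?case
      using fun_space.span_diff[OF step.IH subsetD[OF sub Suc.IH[OF Suc_leD[OF step.hyps(1)]]]]
      by (simp only:)
  qed
qed

section \<open>Spline errors of clusters of consecutive atoms\<close>

text \<open>Coefficients are attached to the indices in \<open>Y\<close>, not to the values
  \<open>f y\<close>, so that they can be transferred to another family indexed by
  \<open>Y\<close>.\<close>

lemma span_image_explicit:
  assumes "finite Y" "h \<in> fun_space.span (f ` Y)"
  shows "\<exists>c. \<forall>x. h x = (\<Sum>y\<in>Y. c y * f y x)"
  using assms(2)
proof (induction rule: fun_space.span_induct_alt)
  case base
  show ?case by (rule exI[of _ "\<lambda>_. 0"]) simp
next
  case (step a w h)
  then obtain y c where y: "y \<in> Y" "w = f y" and c: "\<forall>x. h x = (\<Sum>y\<in>Y. c y * f y x)" by auto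
  have "((\<lambda>x. a * w x) + h) x = (\<Sum>t\<in>Y. (c t + (if t = y then a else 0)) * f t x)" for x
    using y c assms(1) by (simp add: distrib_right sum.distrib if_distrib[of "\<lambda>u. u * _"] sum.delta')
  then show ?case by (intro exI[of _ "\<lambda>t. c t + (if t = y then a else 0)"]) blast
qed

lemma span_sum_scale:
  assumes "\<And>y. y \<in> Y \<Longrightarrow> f y \<in> fun_space.span W"
  shows "(\<lambda>x. \<Sum>y\<in>Y. c y * f y x) \<in> fun_space.span W"
proof -
  have "(\<Sum>y\<in>Y. (\<lambda>x. c y * f y x)) \<in> fun_space.span W"
    by (intro fun_space.span_sum fun_space.span_scale assms)
  moreover have "(\<Sum>y\<in>Y. (\<lambda>x. c y * f y x)) = (\<lambda>x. \<Sum>y\<in>Y. c y * f y x)"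
    by (induction Y rule: infinite_finite_induct) (auto simp: fun_eq_iff)
  ultimately show ?thesis by simp
qed

text \<open>What remains of \<open>phi N (Suc k) j\<close> after subtracting its approximation by the atoms at \<open>z, \<dots>, z + k\<close>;
  for \<open>z = 1\<close>, after subtracting a polynomial.\<close>

definition spline_error :: "nat \<Rightarrow> nat \<Rightarrow> nat \<Rightarrow> nat \<Rightarrow> nat \<Rightarrow> real" where
  "spline_error N k z j x =
    (if x \<in> {1..N} \<and> z \<le> x then (trunc_binom k j x - poly_binom k j x) / real N ^ k else 0)"

text \<open>The error lives on \<open>{z..<j}\<close> and is at most
  \<open>(real (j - z) / real N) ^ k\<close> in absolute value; the number of points contributes one
  more factor \<open>j - z\<close> to the sum of squares.\<close>

lemma L2_set_spline_error_le:
  assumes "z \<le> j"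
  shows "L2_set (spline_error N k z j) {1..N} \<le> sqrt (real (j - z) ^ (2 * k + 1) / real N ^ (2 * k))"
proof -
  have bd: "(spline_error N k z j x)\<^sup>2 \<le> (if x \<in> {z..<j} then (real (j - z) / real N) ^ (2 * k) else 0)"
    for x
  proof (cases "x \<in> {1..N} \<and> z \<le> x \<and> x < j")
    case True
    then have "\<bar>spline_error N k z j x\<bar> = \<bar>poly_binom k j x\<bar> / real N ^ k"
      by (simp add: spline_error_def trunc_binom_def)
    also have "\<dots> \<le> real (j - x) ^ k / real N ^ k"
      using True by (intro divide_right_mono abs_poly_binom_le) auto
    also have "\<dots> \<le> real (j - z) ^ k / real N ^ k"
      using True by (intro divide_right_mono power_mono) auto
    finally have "\<bar>spline_error N k z j x\<bar> \<le> (real (j - z) / real N) ^ k"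
      by (simp add: power_divide)
    then have "\<bar>spline_error N k z j x\<bar>\<^sup>2 \<le> ((real (j - z) / real N) ^ k)\<^sup>2"
      by (rule power_mono) simp
    then show ?thesis using True by (simp add: mult.commute flip: power_mult)
  next
    case False
    then have "spline_error N k z j x = 0"
      by (auto simp: spline_error_def trunc_binom_eq_poly_binom)
    then show ?thesis by simp
  qed
  have "(\<Sum>x\<in>{1..N}. (spline_error N k z j x)\<^sup>2)
      \<le> (\<Sum>x\<in>{1..N}. if x \<in> {z..<j} then (real (j - z) / real N) ^ (2 * k) else 0)"
    by (rule sum_mono) (rule bd)
  also have "\<dots> = (\<Sum>x\<in>{1..N} \<inter> {z..<j}. (real (j - z) / real N) ^ (2 * k))"
    by (rule sum.inter_restrict[symmetric]) simp
  also have "\<dots> \<le> (\<Sum>x\<in>{z..<j}. (real (j - z) / real N) ^ (2 * k))"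
    by (rule sum_mono2) auto
  also have "\<dots> = real (j - z) ^ (2 * k + 1) / real N ^ (2 * k)"
    using assms by (simp add: power_divide of_nat_diff)
  finally show ?thesis by (simp add: L2_set_def)
qed

text \<open>The coefficients of the polynomials are reused for the atoms: within
  \<open>{1..N}\<close>, the atoms of the cluster equal their scaled polynomials from
  \<open>z\<close> on, and before \<open>z\<close> everything vanishes.\<close>

lemma phi_minus_spline_error_in_span:
  assumes "Suc k \<le> z" "z \<le> j"
  shows "phi N (Suc k) j - spline_error N k z j \<in> fun_space.span (phi N (Suc k) ` {z..z + k})"
proof -
  obtain c where c: "\<forall>x. poly_binom k j x = (\<Sum>y\<in>{z..z + k}. c y * poly_binom k y x)"
    using span_image_explicit[OF _ poly_binom_in_span_consecutive[OF assms(2), of k]] by blast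
  have "(phi N (Suc k) j - spline_error N k z j) x = (\<Sum>y\<in>{z..z + k}. c y * phi N (Suc k) y x)"
    for x
  proof (cases "x \<in> {1..N} \<and> z \<le> x")
    case True
    have "(\<Sum>y\<in>{z..z + k}. c y * phi N (Suc k) y x)
      = (\<Sum>y\<in>{z..z + k}. c y * poly_binom k y x / real N ^ k)"
      using True assms
      by (intro sum.cong refl) (simp add: phi_eq_trunc_binom trunc_binom_eq_poly_binom del: phi.simps)
    also have "\<dots> = poly_binom k j x / real N ^ k"
      by (simp add: c sum_divide_distrib)
    finally show ?thesis
      using True assms
      by (simp add: phi_eq_trunc_binom spline_error_def diff_divide_distrib del: phi.simps)
  next
    case False
    then have "phi N (Suc k) y x = 0" if "z \<le> y" for y
      using that assms by (auto simp: phi_eq_trunc_binom trunc_binom_def simp del: phi.simps)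
    then show ?thesis using False assms by (auto simp: spline_error_def simp del: phi.simps)
  qed
  then have "phi N (Suc k) j - spline_error N k z j
      = (\<lambda>x. \<Sum>y\<in>{z..z + k}. c y * phi N (Suc k) y x)" by (rule ext)
  then show ?thesis
    by (simp only:) (rule span_sum_scale, rule fun_space.span_base, rule imageI)
qed

text \<open>Since \<open>Suc l \<le> x + l\<close> for \<open>x \<ge> 1\<close>, the atoms
  \<open>phi N (Suc l) (Suc l)\<close> are scaled polynomials on all of
  \<open>{1..N}\<close>.\<close>

lemma phi_minus_spline_error_in_poly_span:
  assumes "Suc k \<le> j"
  shows "phi N (Suc k) j - spline_error N k 1 j \<in> fun_space.span ((\<lambda>l. phi N l l) ` {1..Suc k})"
proof -
  obtain c where c: "\<forall>x. poly_binom k j x = (\<Sum>l\<in>{0..k}. c l * poly_binom l (Suc l) x)"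
    using span_image_explicit[OF _ poly_binom_in_span_diagonal[OF assms]] by blast
  \<comment> \<open>The factor exchanges the scaling \<open>real N ^ l\<close> of
    \<open>phi N (Suc l)\<close> for the common scaling \<open>real N ^ k\<close>.\<close>
  have "(phi N (Suc k) j - spline_error N k 1 j) x
      = (\<Sum>l\<in>{0..k}. (c l * real N ^ l / real N ^ k) * phi N (Suc l) (Suc l) x)" for x
  proof (cases "x \<in> {1..N}")
    case True
    have "(\<Sum>l\<in>{0..k}. (c l * real N ^ l / real N ^ k) * phi N (Suc l) (Suc l) x)
      = (\<Sum>l\<in>{0..k}. c l * poly_binom l (Suc l) x / real N ^ k)"
      using True
      by (intro sum.cong refl) (simp add: phi_eq_trunc_binom trunc_binom_eq_poly_binom del: phi.simps)
    also have "\<dots> = poly_binom k j x / real N ^ k"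
      by (simp add: c sum_divide_distrib)
    finally show ?thesis
      using True assms
      by (simp add: phi_eq_trunc_binom spline_error_def diff_divide_distrib del: phi.simps)
  next
    case False
    have "phi N l i x = 0" for l i using False by (rule phi_vanishes)
    moreover have "spline_error N k 1 j x = 0" by (simp only: spline_error_def False simp_thms if_False)
    ultimately show ?thesis by (simp del: phi.simps)
  qed
  then have "phi N (Suc k) j - spline_error N k 1 j
      = (\<lambda>x. \<Sum>l\<in>{0..k}. (c l * real N ^ l / real N ^ k) * phi N (Suc l) (Suc l) x)" by (rule ext)
  then show ?thesis
    by (simp only:) (rule span_sum_scale, rule fun_space.span_base, auto simp del: phi.simps)
qed

subsection \<open>Approximation in one dimension\<close>

text \<open>\<open>u\<close> is the part of \<open>e\<close> orthogonal to \<open>W\<close>;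
  Cauchy-Schwarz is applied to \<open>ip I u u = ip I u e\<close>.\<close>

lemma L2_set_orthogonal_le:
  assumes "\<And>w. w \<in> W \<Longrightarrow> ip I u w = 0" "u - e \<in> fun_space.span W"
  shows "L2_set u I \<le> L2_set e I"
proof -
  have "ip I u (u - e) = 0" using ip_span assms by blast
  then have "ip I u u = ip I u e" using ip_diff_left[of I u e u] by (simp add: ip_commute)
  moreover have "(L2_set u I)\<^sup>2 = ip I u u"
    by (simp add: L2_set_def ip_def sum_nonneg flip: power2_eq_square)
  ultimately have "(L2_set u I)\<^sup>2 = ip I u e" by simp
  also have "\<dots> \<le> (\<Sum>x\<in>I. \<bar>u x\<bar> * \<bar>e x\<bar>)"
    unfolding ip_def abs_mult[symmetric] by (rule sum_mono) (rule abs_ge_self)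
  also have "\<dots> \<le> L2_set u I * L2_set e I" by (rule L2_set_mult_ineq)
  finally have "L2_set u I * L2_set u I \<le> L2_set u I * L2_set e I" by (simp add: power2_eq_square)
  then show ?thesis
    using L2_set_nonneg[of u I] L2_set_nonneg[of e I] by (cases "L2_set u I = 0") auto
qed

lemma antiproj_spec:
  assumes "finite I" "finite W" "\<forall>w\<in>W. \<forall>x. x \<notin> I \<longrightarrow> w x = 0"
  shows "f - antiproj I W f \<in> fun_space.span W" "\<And>w. w \<in> W \<Longrightarrow> ip I (antiproj I W f) w = 0"
proof -
  have "\<exists>!g. f - g \<in> fun_space.span W \<and> (\<forall>w\<in>fun_space.span W. ip I g w = 0)"
    by (rule antiproj_well_defined) (use assms in auto)
  note * = theI'[OF this, folded antiproj_def]
  show "f - antiproj I W f \<in> fun_space.span W" using * by blast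
  show "ip I (antiproj I W f) w = 0" if "w \<in> W" for w
    using * fun_space.span_base[OF that] by blast
qed

text \<open>Best approximation: any explicit \<open>h\<close> in the span bounds the antiprojection,
  which therefore never has to be computed.\<close>

lemma L2_set_antiproj_le:
  assumes "finite I" "finite W" "\<forall>w\<in>W. \<forall>x. x \<notin> I \<longrightarrow> w x = 0"
    and h: "h \<in> fun_space.span W"
  shows "L2_set (antiproj I W f) I \<le> L2_set (f - h) I"
proof (rule L2_set_orthogonal_le)
  show "ip I (antiproj I W f) w = 0" if "w \<in> W" for w
    using antiproj_spec(2)[OF assms(1-3)] that .
  have "h - (f - antiproj I W f) \<in> fun_space.span W"
    by (intro fun_space.span_diff h antiproj_spec(1)[OF assms(1-3)])
  then show "antiproj I W f - (f - h) \<in> fun_space.span W" by (simp add: algebra_simps)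
qed

section \<open>Atoms after removal of the polynomials\<close>

lemma phi_minus_phit_in_span: "phi N k j - phit N k j \<in> fun_space.span ((\<lambda>l. phi N l l) ` {1..k})"
  and ip_phit: "w \<in> (\<lambda>l. phi N l l) ` {1..k} \<Longrightarrow> ip {1..N} (phit N k j) w = 0"
proof -
  have v: "w x = 0" if "w \<in> (\<lambda>l. phi N l l) ` {1..k}" "x \<notin> {1..N}" for w x
    using that phi_vanishes by blast
  show "phi N k j - phit N k j \<in> fun_space.span ((\<lambda>l. phi N l l) ` {1..k})"
    unfolding phit_def by (rule antiproj_spec(1)) (use v in auto)
  show "w \<in> (\<lambda>l. phi N l l) ` {1..k} \<Longrightarrow> ip {1..N} (phit N k j) w = 0"
    unfolding phit_def by (rule antiproj_spec(2)) (use v in auto)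
qed

text \<open>Linearity of the projection: replacing \<open>phi\<close> by \<open>phit\<close> in a
  combination gives the part of \<open>f\<close> orthogonal to \<open>W\<close>.\<close>

lemma span_phit_of_span_phi:
  assumes "f \<in> fun_space.span (phi N k ` Y)"
  defines "W \<equiv> (\<lambda>l. phi N l l) ` {1..k}"
  shows "\<exists>h\<in>fun_space.span (phit N k ` Y). f - h \<in> fun_space.span W \<and> (\<forall>w\<in>W. ip {1..N} h w = 0)"
  using assms(1)
proof (induction rule: fun_space.span_induct_alt)
  case base
  have "ip {1..N} 0 w = 0" for w by (simp add: ip_def)
  then show ?case
    using fun_space.span_zero by (intro bexI[of _ 0] conjI ballI) (simp_all only: diff_zero)
next
  case (step c w f)
  then obtain y h where y: "y \<in> Y" "w = phi N k y" and h: "h \<in> fun_space.span (phit N k ` Y)"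
    "f - h \<in> fun_space.span W" "\<forall>w\<in>W. ip {1..N} h w = 0" by blast
  let ?h = "(\<lambda>x. c * phit N k y x) + h"
  have 1: "?h \<in> fun_space.span (phit N k ` Y)"
    using y h(1) by (intro fun_space.span_add fun_space.span_scale) (auto intro: fun_space.span_base)
  have 2: "(\<lambda>x. c * (phi N k y - phit N k y) x) + (f - h) \<in> fun_space.span W"
    by (intro fun_space.span_add fun_space.span_scale phi_minus_phit_in_span[of N k y, folded W_def] h(2))
  have 3: "(\<lambda>x. c * (phi N k y - phit N k y) x) + (f - h) = (\<lambda>x. c * w x) + f - ?h"
    by (simp add: y fun_eq_iff algebra_simps)
  have "ip {1..N} ?h v = 0" if "v \<in> W" for v
  proof -
    have "ip {1..N} ?h v = ip {1..N} v ?h" by (rule ip_commute)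
    also have "\<dots> = c * ip {1..N} v (phit N k y) + ip {1..N} v h"
      by (simp only: ip_add_right ip_scale_right)
    also have "ip {1..N} v (phit N k y) = 0"
      using ip_phit[OF that[unfolded W_def], of y] by (subst ip_commute)
    also have "ip {1..N} v h = 0"
      using bspec[OF h(3) that] by (subst ip_commute)
    finally show ?thesis by (simp only: mult_zero_right add_0_right)
  qed
  then show ?case
    using 2[unfolded 3] by (intro bexI[OF _ 1] conjI ballI)
qed

text \<open>\<open>phit N (Suc k) j - h\<close> is the part of the spline error orthogonal to the
  polynomials, so passing from \<open>phi\<close> to \<open>phit\<close> does not enlarge the error
  bound.\<close>

lemma phit_approx_by_cluster:
  assumes "Suc k \<le> z" "z \<le> j"
  obtains h where "h \<in> fun_space.span (phit N (Suc k) ` {z..z + k})"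
    "L2_set (phit N (Suc k) j - h) {1..N} \<le> sqrt (real (j - z) ^ (2 * k + 1) / real N ^ (2 * k))"
proof -
  let ?W = "(\<lambda>l. phi N l l) ` {1..Suc k}" and ?e = "spline_error N k z j"
  obtain h where h: "h \<in> fun_space.span (phit N (Suc k) ` {z..z + k})"
    "phi N (Suc k) j - ?e - h \<in> fun_space.span ?W"
    "\<forall>w\<in>?W. ip {1..N} h w = 0"
    using span_phit_of_span_phi[OF phi_minus_spline_error_in_span[OF assms, of N]] by blast
  have "L2_set (phit N (Suc k) j - h) {1..N} \<le> L2_set ?e {1..N}"
  proof (rule L2_set_orthogonal_le)
    show "ip {1..N} (phit N (Suc k) j - h) w = 0" if "w \<in> ?W" for w
      using bspec[OF h(3) that] ip_phit[OF that] by (simp only: ip_diff_left diff_zero)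
    have "(phi N (Suc k) j - ?e - h) - (phi N (Suc k) j - phit N (Suc k) j) \<in> fun_space.span ?W"
      by (intro fun_space.span_diff h(2) phi_minus_phit_in_span)
    then show "phit N (Suc k) j - h - ?e \<in> fun_space.span ?W"
      by (simp add: algebra_simps del: phi.simps)
  qed
  also note L2_set_spline_error_le[OF assms(2)]
  finally show ?thesis using that h(1) by blast
qed

text \<open>As the polynomials are projected away, zero approximates the atom as well as a cluster
  at \<open>1\<close> would. This handles knots near the left end and bounds the norm of every
  atom.\<close>

lemma L2_set_phit_le:
  assumes "Suc k \<le> j"
  shows "L2_set (phit N (Suc k) j) {1..N} \<le> sqrt (real (j - 1) ^ (2 * k + 1) / real N ^ (2 * k))"
proof -
  let ?W = "(\<lambda>l. phi N l l) ` {1..Suc k}" and ?e = "spline_error N k 1 j"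
  have "L2_set (phit N (Suc k) j) {1..N} \<le> L2_set ?e {1..N}"
  proof (rule L2_set_orthogonal_le)
    show "ip {1..N} (phit N (Suc k) j) w = 0" if "w \<in> ?W" for w
      using ip_phit[OF that] .
    have "(phi N (Suc k) j - ?e) - (phi N (Suc k) j - phit N (Suc k) j) \<in> fun_space.span ?W"
      by (intro fun_space.span_diff phi_minus_spline_error_in_poly_span assms phi_minus_phit_in_span)
    then show "phit N (Suc k) j - ?e \<in> fun_space.span ?W"
      by (simp add: algebra_simps del: phi.simps)
  qed
  also have "\<dots> \<le> sqrt (real (j - 1) ^ (2 * k + 1) / real N ^ (2 * k))"
    by (rule L2_set_spline_error_le) (use assms in simp)
  finally show ?thesis .
qed

section \<open>Approximation from equispaced knots\<close>

text \<open>The first alternative is for points before the first element of \<open>A\<close>, where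
  the atom itself will be small.\<close>

lemma approx_equispaced_near:
  assumes A: "approx_equispaced c N A" and j: "j \<in> {1..N}"
  shows "(real j - 1) * real (card A) \<le> c * real N \<or>
    (\<exists>a\<in>A. a \<le> j \<and> (real j - real a) * real (card A) \<le> c * real N)"
proof -
  have ne: "A \<noteq> {}" and sub: "A \<subseteq> {1..N}"
    and gap: "\<And>a b. a \<in> A \<Longrightarrow> b \<in> A \<Longrightarrow> a < b \<Longrightarrow> A \<inter> {a<..<b} = {} \<Longrightarrow>
      (real b - real a) * real (card A) \<le> c * real N"
    and first: "(real (Min A) - 1) * real (card A) \<le> c * real N"
    and last: "(real N - real (Max A)) * real (card A) \<le> c * real N"
    using A unfolding approx_equispaced_def by blast+
  have fin: "finite A" using sub finite_subset by blast
  show ?thesis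
  proof (cases "\<exists>a\<in>A. a \<le> j")
    case False
    then have "j \<le> Min A" using Min_in[OF fin ne] by (meson linear)
    then have "(real j - 1) * real (card A) \<le> (real (Min A) - 1) * real (card A)"
      by (intro mult_right_mono) auto
    with first show ?thesis by linarith
  next
    case True
    define a where "a = Max {a\<in>A. a \<le> j}"
    have fa: "finite {a\<in>A. a \<le> j}" "{a\<in>A. a \<le> j} \<noteq> {}" using fin True by auto
    have a: "a \<in> A" "a \<le> j" using Max_in[OF fa] by (auto simp: a_def)
    have a_max: "b \<le> a" if "b \<in> A" "b \<le> j" for b
      using that fa unfolding a_def by (intro Max_ge) auto
    \<comment> \<open>\<open>m\<close> is the element of \<open>A\<close> following
      \<open>a\<close>, or \<open>N\<close> if \<open>a\<close> is the last one; either way the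
      spacing conditions bound \<open>m - a\<close>.\<close>
    have "\<exists>m::real. (m - real a) * real (card A) \<le> c * real N \<and> real j \<le> m"
    proof (cases "\<exists>b\<in>A. a < b")
      case True
      define b where "b = Min {b\<in>A. a < b}"
      have fb: "finite {b\<in>A. a < b}" "{b\<in>A. a < b} \<noteq> {}" using fin True by auto
      have b: "b \<in> A" "a < b" using Min_in[OF fb] by (auto simp: b_def)
      have "A \<inter> {a<..<b} = {}"
      proof -
        have "b \<le> b'" if "b' \<in> A" "a < b'" for b'
          using that fb unfolding b_def by (intro Min_le) auto
        then show ?thesis by fastforce
      qed
      then show ?thesis
        using gap[OF a(1) b] a_max[OF b(1)] b(2) by (intro exI[of _ "real b"]) auto
    next
      case False
      then have "Max A = a" using a(1) fin by (intro Max_eqI) auto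
      then show ?thesis using last j by (intro exI[of _ "real N"]) auto
    qed
    then obtain m where m: "(m - real a) * real (card A) \<le> c * real N" "real j \<le> m" by blast
    have "(real j - real a) * real (card A) \<le> (m - real a) * real (card A)"
      using m(2) by (intro mult_right_mono) auto
    with m(1) a show ?thesis by force
  qed
qed

text \<open>With \<open>t\<close> the distance relative to \<open>N\<close>, the left side is
  \<open>sqrt N\<close> times \<open>t powr (k + 1/2)\<close>. \<open>M\<close> stands for a number
  of knots, so \<open>K / M\<close> is a relative spacing.\<close>

lemma sqrt_spline_bound:
  fixes K M :: real
  assumes "real g * M \<le> K * real N" "0 < M" "0 < N"
  shows "sqrt (real g ^ (2 * k + 1) / real N ^ (2 * k)) \<le> sqrt (real N) * (K / M) powr (real k + 1 / 2)"
proof -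
  define t where "t = real g / real N"
  have t: "0 \<le> t" "t \<le> K / M" using assms by (auto simp: t_def field_simps)
  have "real g ^ (2 * k + 1) / real N ^ (2 * k) = real N * t ^ (2 * k + 1)"
    using assms(3) by (simp add: t_def power_divide)
  then have "sqrt (real g ^ (2 * k + 1) / real N ^ (2 * k)) = sqrt (real N) * sqrt (t ^ (2 * k + 1))"
    by (simp add: real_sqrt_mult)
  also have "sqrt (t ^ (2 * k + 1)) = t powr (real k + 1 / 2)"
  proof (cases "t = 0")
    case False
    then have "t powr real (2 * k + 1) = t ^ (2 * k + 1)" using t by (subst powr_realpow) auto
    then have "sqrt (t ^ (2 * k + 1)) = (t powr real (2 * k + 1)) powr (1 / 2)"
      using t by (simp only: powr_half_sqrt zero_le_power)
    then show ?thesis by (simp add: powr_powr add_divide_distrib add.commute)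
  qed simp
  also have "\<dots> \<le> (K / M) powr (real k + 1 / 2)"
    using t by (intro powr_mono2) auto
  finally show ?thesis by (simp add: mult_left_mono)
qed

text \<open>Near the left end \<open>0\<close> is good enough, an atom inside a cluster is its own
  approximant, and all others use the cluster of a nearby knot to the left.\<close>

lemma phit_approx:
  assumes A: "approx_equispaced c N A" and j: "Suc (Suc k) \<le> j" "j \<le> N"
  shows "\<exists>h\<in>fun_space.span (phit N (Suc k) `
        ((\<Union>h\<in>{0..<Suc k}. (\<lambda>z. z + h) ` A) \<inter> {Suc (Suc k)..N})).
      L2_set (phit N (Suc k) j - h) {1..N}
        \<le> sqrt (real N) * ((\<bar>c\<bar> + real k + 1) / real (card A)) powr (real k + 1 / 2)"
    (is "\<exists>h\<in>fun_space.span (_ ` ?Y). L2_set (_ - h) _ \<le> ?B")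
proof -
  \<comment> \<open>\<open>\<bar>c\<bar>\<close> accounts for the spacing, \<open>real k\<close> for
    elements of \<open>A\<close> below the admissible knots, and \<open>1\<close> makes the constant
    positive for every \<open>c\<close>.\<close>
  let ?K = "\<bar>c\<bar> + real k + 1"
  have sub: "A \<subseteq> {1..N}" and ne: "A \<noteq> {}" using A unfolding approx_equispaced_def by blast+
  then have card: "card A \<le> N" "0 < card A"
    using card_mono[OF _ sub] finite_subset[OF sub] by (auto simp: card_gt_0_iff)
  have cK: "c * real N \<le> \<bar>c\<bar> * real N" by (intro mult_right_mono) auto
  have zero: ?thesis if "(real j - 1) * real (card A) \<le> ?K * real N"
  proof -
    have "L2_set (phit N (Suc k) j) {1..N} \<le> sqrt (real (j - 1) ^ (2 * k + 1) / real N ^ (2 * k))"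
      using j by (intro L2_set_phit_le) auto
    also have "\<dots> \<le> ?B"
      by (rule sqrt_spline_bound) (use that card j in \<open>auto simp: of_nat_diff\<close>)
    finally have "L2_set (phit N (Suc k) j - 0) {1..N} \<le> ?B" by (simp only: diff_zero)
    then show ?thesis using fun_space.span_zero by (rule bexI)
  qed
  consider "(real j - 1) * real (card A) \<le> c * real N" |
    a where "a \<in> A" "a \<le> j" "(real j - real a) * real (card A) \<le> c * real N"
    using approx_equispaced_near[OF A, of j] j by auto
  then show ?thesis
  proof cases
    case 1
    have "c * real N \<le> ?K * real N" by (intro mult_right_mono) auto
    with 1 zero show ?thesis by linarith
  next
    case (2 a)
    show ?thesis
    proof (cases "Suc (Suc k) \<le> a")
      case False
      \<comment> \<open>The cluster at \<open>a\<close> would contain inadmissible knots, but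
        \<open>a \<le> Suc k\<close> puts \<open>j\<close> itself near \<open>1\<close>.\<close>
      have "(real a - 1) * real (card A) \<le> real k * real N"
        using False card by (intro mult_mono) auto
      then have "(real j - 1) * real (card A) \<le> c * real N + real k * real N"
        using 2(3) by (simp add: algebra_simps)
      also have "\<dots> \<le> ?K * real N" using cK by (simp add: algebra_simps)
      finally show ?thesis by (rule zero)
    next
      case a: True
      show ?thesis
      \<comment> \<open>Either \<open>j\<close> is itself a knot of the cluster, or the whole
        cluster lies left of \<open>j\<close> and hence does not exceed \<open>N\<close>.\<close>
      proof (cases "j \<le> a + k")
        case True
        have "j \<in> ?Y" using j 2 True by (auto intro!: bexI[of _ "j - a"] image_eqI[of _ _ a])
        then have "phit N (Suc k) j \<in> fun_space.span (phit N (Suc k) ` ?Y)"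
          by (intro fun_space.span_base imageI)
        moreover have "L2_set (phit N (Suc k) j - phit N (Suc k) j) {1..N} = 0"
          by (simp add: L2_set_def)
        ultimately show ?thesis by (intro bexI[of _ "phit N (Suc k) j"]) simp_all
      next
        case False
        obtain h where h: "h \<in> fun_space.span (phit N (Suc k) ` {a..a + k})"
          "L2_set (phit N (Suc k) j - h) {1..N} \<le> sqrt (real (j - a) ^ (2 * k + 1) / real N ^ (2 * k))"
          using phit_approx_by_cluster[of k a j N] a 2(2) by auto
        have "{a..a + k} \<subseteq> ?Y"
        proof
          fix y assume "y \<in> {a..a + k}"
          then show "y \<in> ?Y"
            using a 2(1) False j by (auto intro!: bexI[of _ "y - a"] image_eqI[of _ _ a])
        qed
        then have "h \<in> fun_space.span (phit N (Suc k) ` ?Y)"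
          using h(1) fun_space.span_mono[OF image_mono] by blast
        moreover have "sqrt (real (j - a) ^ (2 * k + 1) / real N ^ (2 * k)) \<le> ?B"
        proof (rule sqrt_spline_bound)
          have "c * real N \<le> ?K * real N" by (intro mult_right_mono) auto
          then show "real (j - a) * real (card A) \<le> ?K * real N"
            using 2 by (simp add: of_nat_diff)
        qed (use card j in auto)
        ultimately show ?thesis using h(2) by force
      qed
    qed
  qed
qed

subsection \<open>Tensor products\<close>

definition tensor :: "nat \<Rightarrow> (nat \<Rightarrow> nat) \<Rightarrow> (nat \<Rightarrow> nat \<Rightarrow> real) \<Rightarrow> (nat \<Rightarrow> nat) \<Rightarrow> real" where
  "tensor d n f = (\<lambda>x. if x \<in> grid_box d n then \<Prod>i\<in>{1..d}. f i (x i) else 0)"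

lemma phit_tensor_eq_tensor: "phit_tensor d n k j = tensor d n (\<lambda>i. phit (n i) k (j i))"
  by (simp add: phit_tensor_def tensor_def)

lemma finite_grid_box: "finite (grid_box d n)"
  unfolding grid_box_def by (intro finite_PiE) auto

lemma sqrt_prod: "sqrt (prod f A) = (\<Prod>x\<in>A. sqrt (f x))"
  by (induction A rule: infinite_finite_induct) (auto simp: real_sqrt_mult)

lemma L2_set_tensor: "L2_set (tensor d n f) (grid_box d n) = (\<Prod>i\<in>{1..d}. L2_set (f i) {1..n i})"
proof -
  have "(\<Sum>x\<in>grid_box d n. (tensor d n f x)\<^sup>2)
      = (\<Sum>x\<in>grid_box d n. \<Prod>i\<in>{1..d}. (f i (x i))\<^sup>2)"
    by (intro sum.cong refl) (simp add: tensor_def prod_power_distrib)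
  also have "\<dots> = (\<Prod>i\<in>{1..d}. \<Sum>x\<in>{1..n i}. (f i x)\<^sup>2)"
    unfolding grid_box_def by (subst prod_sum_PiE) auto
  finally have "L2_set (tensor d n f) (grid_box d n) = sqrt (\<Prod>i\<in>{1..d}. \<Sum>x\<in>{1..n i}. (f i x)\<^sup>2)"
    by (simp add: L2_set_def)
  then show ?thesis by (simp only: sqrt_prod L2_set_def)
qed

lemma tensor_sum:
  assumes "\<And>i. i \<in> {1..d} \<Longrightarrow> finite (B i)"
    and "\<And>i x. i \<in> {1..d} \<Longrightarrow> f i x = (\<Sum>y\<in>B i. g i y x)"
  shows "tensor d n f x = (\<Sum>l\<in>PiE {1..d} B. tensor d n (\<lambda>i. g i (l i)) x)"
proof (cases "x \<in> grid_box d n")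
  case True
  have "(\<Prod>i\<in>{1..d}. f i (x i)) = (\<Prod>i\<in>{1..d}. \<Sum>y\<in>B i. g i y (x i))"
    by (intro prod.cong refl assms(2))
  also have "\<dots> = (\<Sum>l\<in>PiE {1..d} B. \<Prod>i\<in>{1..d}. g i (l i) (x i))"
    by (rule prod_sum_PiE) (auto intro: assms(1))
  finally show ?thesis using True by (simp add: tensor_def)
qed (simp add: tensor_def)

text \<open>Multilinearity: the coefficient of a tensor atom is the product of the one-dimensional
  coefficients.\<close>

lemma tensor_in_span:
  assumes "\<And>i. i \<in> {1..d} \<Longrightarrow> finite (Y i)"
    and "\<And>i. i \<in> {1..d} \<Longrightarrow> f i \<in> fun_space.span (w i ` Y i)"
  shows "tensor d n f \<in> fun_space.span ((\<lambda>j. tensor d n (\<lambda>i. w i (j i))) ` PiE {1..d} Y)"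
proof -
  have "\<forall>i\<in>{1..d}. \<exists>c. \<forall>x. f i x = (\<Sum>y\<in>Y i. c y * w i y x)"
    using span_image_explicit assms by blast
  then obtain c where c: "\<And>i x. i \<in> {1..d} \<Longrightarrow> f i x = (\<Sum>y\<in>Y i. c i y * w i y x)"
    by metis
  have "tensor d n f x
      = (\<Sum>j\<in>PiE {1..d} Y. (\<Prod>i\<in>{1..d}. c i (j i)) * tensor d n (\<lambda>i. w i (j i)) x)" for x
  proof -
    have "tensor d n f x = (\<Sum>j\<in>PiE {1..d} Y. tensor d n (\<lambda>i x. c i (j i) * w i (j i) x) x)"
      using assms(1) c by (rule tensor_sum[where g = "\<lambda>i y x. c i y * w i y x"])
    then show ?thesis by (auto simp: tensor_def prod.distrib intro!: sum.cong)
  qed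
  then have "tensor d n f
      = (\<lambda>x. \<Sum>j\<in>PiE {1..d} Y. (\<Prod>i\<in>{1..d}. c i (j i)) * tensor d n (\<lambda>i. w i (j i)) x)"
    by (rule ext)
  then show ?thesis
    by (simp only:) (rule span_sum_scale, rule fun_space.span_base, rule imageI)
qed

lemma L2_set_sum_le: "L2_set (\<lambda>x. \<Sum>t\<in>T. g t x) I \<le> (\<Sum>t\<in>T. L2_set (g t) I)"
proof (induction T rule: infinite_finite_induct)
  case (insert t T)
  have "L2_set (\<lambda>x. \<Sum>t\<in>insert t T. g t x) I = L2_set (\<lambda>x. g t x + (\<Sum>t\<in>T. g t x)) I"
    using insert.hyps by simp
  also have "\<dots> \<le> L2_set (g t) I + L2_set (\<lambda>x. \<Sum>t\<in>T. g t x) I"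
    by (rule L2_set_triangle_ineq)
  finally show ?case using insert by simp
qed (simp_all add: L2_set_def)

lemma L2_set_diff_le: "L2_set (f - g) I \<le> L2_set (u - f) I + L2_set (u - g) I"
proof -
  have "L2_set (f - g) I = L2_set (\<lambda>x. (u - g) x + (f - u) x) I"
    by (rule L2_set_cong) auto
  also have "\<dots> \<le> L2_set (u - g) I + L2_set (f - u) I" by (rule L2_set_triangle_ineq)
  also have "L2_set (f - u) I = L2_set (u - f) I"
    unfolding L2_set_def by (simp add: power2_commute)
  finally show ?thesis by (simp only: add.commute)
qed

section \<open>Admissible levels and the telescoped tensor product\<close>

lemma finite_levels: "finite (levels d)"
  unfolding levels_def by (rule finite_subset[of _ "{1..d} \<rightarrow>\<^sub>E {1..d}"]) (auto intro: finite_PiE)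

text \<open>A zero index gives \<open>z = 0\<close>; otherwise the condition of
  \<open>levels d\<close> fails at some \<open>z\<close>, and \<open>z < d\<close> because at most
  \<open>d\<close> indices are counted.\<close>

lemma not_levels_obtain:
  assumes "l \<in> {1..d} \<rightarrow>\<^sub>E {0..d}" "l \<notin> levels d"
  obtains z where "z < d" "z < card {i\<in>{1..d}. l i \<le> z}"
proof (cases "\<exists>i\<in>{1..d}. l i = 0")
  case True
  then obtain i where "i \<in> {1..d}" "l i = 0" by blast
  then have "{i\<in>{1..d}. l i \<le> 0} \<noteq> {}" "0 < d" by auto
  moreover have "finite {i\<in>{1..d}. l i \<le> 0}" by simp
  ultimately have "0 < d" "0 < card {i\<in>{1..d}. l i \<le> 0}" by (simp_all only: card_gt_0_iff simp_thms)
  then show ?thesis by (rule that)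
next
  case False
  then have "l i \<in> {1..d}" if "i \<in> {1..d}" for i
    using PiE_mem[OF assms(1) that] that by (auto simp: Suc_le_eq)
  moreover have "l \<in> extensional {1..d}" using assms(1) by (simp only: PiE_iff)
  ultimately have "l \<in> {1..d} \<rightarrow>\<^sub>E {1..d}" unfolding PiE_iff by blast
  then have "\<not> (\<forall>z\<in>{1..d}. card {i\<in>{1..d}. l i \<le> z} \<le> z)"
    using assms(2) unfolding levels_def by blast
  then obtain z where z: "z \<in> {1..d}" "z < card {i\<in>{1..d}. l i \<le> z}"
    unfolding not_le[symmetric] by blast
  have "card {i\<in>{1..d}. l i \<le> z} \<le> card {1..d}" by (rule card_mono) auto
  then show ?thesis using that[of z] z by simp
qed

text \<open>The telescoping argument, detached from splines. In the constant,
  \<open>(d + 1) ^ d\<close> bounds the number of terms, and \<open>2 ^ d\<close> arises because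
  each factor is a difference of two approximants.\<close>

lemma tensor_levels_approx:
  fixes v :: "nat \<Rightarrow> nat \<Rightarrow> real" and P :: "nat \<Rightarrow> nat \<Rightarrow> nat \<Rightarrow> real"
    and b :: "nat \<Rightarrow> real" and \<eta> :: real
  assumes \<eta>: "0 < \<eta>" "\<eta> \<le> 1"
    and fin: "\<And>i l. i \<in> {1..d} \<Longrightarrow> l \<in> {1..d} \<Longrightarrow> finite (Y i l)"
    and nested: "\<And>i l l'. i \<in> {1..d} \<Longrightarrow> l \<in> {1..d} \<Longrightarrow> l' \<in> {1..d} \<Longrightarrow> l \<le> l' \<Longrightarrow> Y i l' \<subseteq> Y i l"
    and P: "\<And>i l. i \<in> {1..d} \<Longrightarrow> l \<in> {1..d} \<Longrightarrow> P i l \<in> fun_space.span (w i ` Y i l)"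
    and err: "\<And>i l. i \<in> {1..d} \<Longrightarrow> l \<in> {1..d} \<Longrightarrow>
      L2_set (v i - P i l) {1..n i} \<le> b i * \<eta> powr (1 / real l)"
    and nrm: "\<And>i. i \<in> {1..d} \<Longrightarrow> L2_set (v i) {1..n i} \<le> b i"
  shows "\<exists>h\<in>fun_space.span ((\<lambda>j. tensor d n (\<lambda>i. w i (j i))) ` (\<Union>l\<in>levels d. \<Pi>\<^sub>E i\<in>{1..d}. Y i (l i))).
    L2_set (tensor d n v - h) (grid_box d n) \<le> real (d + 1) ^ d * (2 ^ d * (\<Prod>i\<in>{1..d}. b i) * \<eta>)"
proof -
  \<comment> \<open>Level \<open>0\<close> is the exact factor and level \<open>d + 1\<close> is
    zero, so the differences over \<open>{0..d}\<close> telescope to \<open>v i\<close>.\<close>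
  define Q where "Q i l = (if l = 0 then v i else if l \<le> d then P i l else (\<lambda>x. 0))" for i l
  define \<Delta> where "\<Delta> i l = Q i l - Q i (Suc l)" for i l
  \<comment> \<open>Bounds the error of the coarser approximant \<open>Q i (Suc l)\<close> relative
    to \<open>b i\<close>; for \<open>l = d\<close> it is zero and only the norm bound
    remains.\<close>
  define e where "e l = (if l < d then \<eta> powr (1 / real (l + 1)) else 1)" for l
  have b0: "0 \<le> b i" if "i \<in> {1..d}" for i
    using nrm[OF that] L2_set_nonneg order_trans by blast
  have e: "0 \<le> e l" "e l \<le> 1" for l
    using \<eta> powr_le1 by (auto simp: e_def)
  have L0: "L2_set (v i - v i) {1..n i} = 0" for i by (simp add: L2_set_def)
  have Qe: "L2_set (v i - Q i (Suc l)) {1..n i} \<le> b i * e l" if "i \<in> {1..d}" "l \<le> d" for i l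
  proof (cases "l < d")
    case True
    then show ?thesis using err[OF that(1), of "Suc l"] by (simp add: Q_def e_def)
  next
    case False
    then have "v i - Q i (Suc l) = v i" using that by (simp add: Q_def fun_eq_iff)
    then show ?thesis using False nrm[OF that(1)] by (simp only: e_def) simp
  qed
  have Qe': "L2_set (v i - Q i l) {1..n i} \<le> b i * e l" if "i \<in> {1..d}" "l \<le> d" for i l
  proof (cases l)
    case 0
    then have "Q i l = v i" by (simp add: Q_def)
    then show ?thesis using b0[OF that(1)] e(1)[of l] by (simp only: L0) simp
  next
    case (Suc m)
    have "e m \<le> e l"
    proof (cases "l < d")
      case True
      have "\<eta> powr (1 / real (m + 1)) \<le> \<eta> powr (1 / real (l + 1))"
        using Suc \<eta> by (intro powr_mono') (auto simp: frac_le)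
      then show ?thesis using Suc True by (simp add: e_def)
    next
      case False
      then have "e l = 1" by (simp add: e_def)
      then show ?thesis using e by simp
    qed
    then have "b i * e m \<le> b i * e l" using b0[OF that(1)] by (rule mult_left_mono)
    then show ?thesis using Qe[OF that(1), of m] Suc that(2) by simp
  qed
  have \<Delta>_le: "L2_set (\<Delta> i l) {1..n i} \<le> 2 * b i * e l" if "i \<in> {1..d}" "l \<le> d" for i l
    using L2_set_diff_le[of "Q i l" "Q i (Suc l)" "{1..n i}" "v i"] Qe[OF that] Qe'[OF that]
    unfolding \<Delta>_def by linarith
  have \<Delta>_span: "\<Delta> i l \<in> fun_space.span (w i ` Y i l)" if "i \<in> {1..d}" "l \<in> {1..d}" for i l
  proof -
    have "Q i l \<in> fun_space.span (w i ` Y i l)" using P[OF that] that by (simp add: Q_def)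
    moreover have "Q i (Suc l) \<in> fun_space.span (w i ` Y i l)"
    proof (cases "Suc l \<le> d")
      case True
      \<comment> \<open>Coarser levels have smaller knot sets, so both parts of the difference lie
        in the span of level \<open>l\<close>.\<close>
      then have "Y i (Suc l) \<subseteq> Y i l" using that by (intro nested) auto
      then have "fun_space.span (w i ` Y i (Suc l)) \<subseteq> fun_space.span (w i ` Y i l)"
        by (intro fun_space.span_mono image_mono)
      moreover have "Q i (Suc l) \<in> fun_space.span (w i ` Y i (Suc l))"
        using P[OF that(1), of "Suc l"] True by (simp add: Q_def)
      ultimately show ?thesis by blast
    next
      case False
      then have eq: "Q i (Suc l) = 0" by (simp add: Q_def fun_eq_iff)
      show ?thesis unfolding eq by (rule fun_space.span_zero)
    qed
    ultimately show ?thesis unfolding \<Delta>_def by (rule fun_space.span_diff)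
  qed
  have tele: "v i x = (\<Sum>l\<in>{0..d}. \<Delta> i l x)" for i x
  proof -
    have "(\<Sum>l\<in>{0..d}. \<Delta> i l x) = - (\<Sum>l\<in>{0..d}. Q i (Suc l) x - Q i l x)"
      by (simp add: \<Delta>_def flip: sum_negf)
    also have "\<dots> = Q i 0 x - Q i (Suc d) x" by (subst sum_Suc_diff) auto
    finally show ?thesis by (simp add: Q_def)
  qed
  let ?G = "{1..d} \<rightarrow>\<^sub>E {0..d}"
  let ?t = "\<lambda>l. tensor d n (\<lambda>i. \<Delta> i (l i))"
  have fG: "finite ?G" by (intro finite_PiE) auto
  have "levels d \<subseteq> {1..d} \<rightarrow>\<^sub>E {1..d}" unfolding levels_def by blast
  also have "\<dots> \<subseteq> ?G" by (intro PiE_mono) auto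
  finally have LG: "levels d \<subseteq> ?G" .
  have v_eq: "tensor d n v x = (\<Sum>l\<in>?G. ?t l x)" for x
    by (rule tensor_sum) (auto intro: tele)
  define h where "h = (\<lambda>x. \<Sum>l\<in>levels d. 1 * ?t l x)"
  let ?S = "(\<lambda>j. tensor d n (\<lambda>i. w i (j i))) ` (\<Union>l\<in>levels d. \<Pi>\<^sub>E i\<in>{1..d}. Y i (l i))"
  have "h \<in> fun_space.span ?S"
    unfolding h_def
  proof (rule span_sum_scale)
    fix l assume l: "l \<in> levels d"
    then have l1: "l i \<in> {1..d}" if "i \<in> {1..d}" for i using that by (auto simp: levels_def PiE_iff)
    have "?t l \<in> fun_space.span ((\<lambda>j. tensor d n (\<lambda>i. w i (j i))) ` (\<Pi>\<^sub>E i\<in>{1..d}. Y i (l i)))"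
      using l1 by (intro tensor_in_span fin \<Delta>_span) auto
    moreover have "fun_space.span ((\<lambda>j. tensor d n (\<lambda>i. w i (j i))) ` (\<Pi>\<^sub>E i\<in>{1..d}. Y i (l i)))
        \<subseteq> fun_space.span ?S"
      using l by (intro fun_space.span_mono image_mono) auto
    ultimately show "?t l \<in> fun_space.span ?S" by blast
  qed
  moreover have "L2_set (tensor d n v - h) (grid_box d n) \<le> real (d + 1) ^ d * (2 ^ d * (\<Prod>i\<in>{1..d}. b i) * \<eta>)"
  proof -
    have e_prod: "(\<Prod>i\<in>{1..d}. e (l i)) \<le> \<eta>" if l: "l \<in> ?G - levels d" for l
    proof -
      obtain z where z: "z < d" "z < card {i\<in>{1..d}. l i \<le> z}"
        using not_levels_obtain[of l d] l by blast
      let ?I = "{i\<in>{1..d}. l i \<le> z}"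
      have "(\<Prod>i\<in>{1..d}. e (l i)) = (\<Prod>i\<in>?I. e (l i)) * (\<Prod>i\<in>{1..d} - ?I. e (l i))"
        by (subst prod.subset_diff[of ?I]) (auto simp: mult.commute)
      also have "\<dots> \<le> (\<Prod>i\<in>?I. e (l i)) * 1"
        using e by (intro mult_left_mono prod_le_1 prod_nonneg) auto
      also have "\<dots> = (\<Prod>i\<in>?I. e (l i))" by simp
      also have "\<dots> \<le> (\<Prod>i\<in>?I. \<eta> powr (1 / real (z + 1)))"
      proof (rule prod_mono)
        fix i assume i: "i \<in> ?I"
        have "\<eta> powr (1 / real (l i + 1)) \<le> \<eta> powr (1 / real (z + 1))"
          using i \<eta> by (intro powr_mono') (auto simp: frac_le)
        then show "0 \<le> e (l i) \<and> e (l i) \<le> \<eta> powr (1 / real (z + 1))"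
          using i z(1) e(1) by (auto simp: e_def)
      qed
      also have "\<dots> = \<eta> powr (real (card ?I) / real (z + 1))"
        using \<eta> by (simp add: powr_power)
      \<comment> \<open>At least \<open>z + 1\<close> factors occur, so the exponent is at least
        \<open>1\<close>, while \<open>\<eta> \<le> 1\<close>.\<close>
      also have "\<dots> \<le> \<eta> powr 1"
        using z(2) \<eta> by (intro powr_mono') auto
      also have "\<dots> = \<eta>" using \<eta> by simp
      finally show ?thesis .
    qed
    have "tensor d n v - h = (\<lambda>x. \<Sum>l\<in>?G - levels d. ?t l x)"
    proof
      fix x
      show "(tensor d n v - h) x = (\<Sum>l\<in>?G - levels d. ?t l x)"
        using sum.subset_diff[OF LG fG, of "\<lambda>l. ?t l x"] by (simp add: v_eq h_def)
    qed
    then have "L2_set (tensor d n v - h) (grid_box d n) \<le> (\<Sum>l\<in>?G - levels d. L2_set (?t l) (grid_box d n))"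
      by (simp only: L2_set_sum_le)
    also have "\<dots> \<le> (\<Sum>l\<in>?G - levels d. 2 ^ d * (\<Prod>i\<in>{1..d}. b i) * \<eta>)"
    proof (rule sum_mono)
      fix l assume l: "l \<in> ?G - levels d"
      have "L2_set (?t l) (grid_box d n) = (\<Prod>i\<in>{1..d}. L2_set (\<Delta> i (l i)) {1..n i})"
        by (rule L2_set_tensor)
      also have "\<dots> \<le> (\<Prod>i\<in>{1..d}. 2 * b i * e (l i))"
        using l by (intro prod_mono conjI L2_set_nonneg \<Delta>_le) (auto simp: PiE_iff)
      also have "\<dots> = 2 ^ d * (\<Prod>i\<in>{1..d}. b i) * (\<Prod>i\<in>{1..d}. e (l i))"
        by (simp add: prod.distrib)
      also have "\<dots> \<le> 2 ^ d * (\<Prod>i\<in>{1..d}. b i) * \<eta>"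
        using b0 e_prod[OF l] by (intro mult_left_mono mult_nonneg_nonneg prod_nonneg) auto
      finally show "L2_set (?t l) (grid_box d n) \<le> 2 ^ d * (\<Prod>i\<in>{1..d}. b i) * \<eta>" .
    qed
    also have "\<dots> = real (card (?G - levels d)) * (2 ^ d * (\<Prod>i\<in>{1..d}. b i) * \<eta>)" by simp
    also have "\<dots> \<le> real ((d + 1) ^ d) * (2 ^ d * (\<Prod>i\<in>{1..d}. b i) * \<eta>)"
    proof (rule mult_right_mono)
      have "card (?G - levels d) \<le> card ?G" using fG by (intro card_mono) auto
      then show "real (card (?G - levels d)) \<le> real ((d + 1) ^ d)"
        by (simp only: of_nat_le_iff) (simp add: card_PiE)
      show "0 \<le> 2 ^ d * (\<Prod>i\<in>{1..d}. b i) * \<eta>"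
        using b0 \<eta> by (intro mult_nonneg_nonneg prod_nonneg) auto
    qed
    finally show ?thesis by simp
  qed
  ultimately show ?thesis by blast
qed

section \<open>Size of the mesh grid\<close>

text \<open>Summation by parts over the counts \<open>|{i. l i \<le> z}|\<close>.\<close>

lemma sum_inverse_levels_le_harm:
  assumes "l \<in> levels d"
  shows "(\<Sum>i\<in>{1..d}. 1 / real (l i)) \<le> (harm d :: real)"
proof -
  define a where "a z = 1 / real z - 1 / real (Suc z)" for z
  have a0: "0 \<le> a z" if "1 \<le> z" for z using that by (auto simp: a_def frac_le)
  have l: "l i \<in> {1..d}" if "i \<in> {1..d}" for i using assms that by (auto simp: levels_def PiE_iff)
  \<comment> \<open>A telescoping tail sum, written with an indicator over a fixed range so that the
    sums over \<open>i\<close> and \<open>z\<close> can be exchanged.\<close>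
  have inv: "1 / real m = 1 / real d + (\<Sum>z\<in>{1..<d}. if m \<le> z then a z else 0)" if "m \<in> {1..d}" for m
  proof -
    have "(\<Sum>z\<in>{1..<d}. if m \<le> z then a z else 0) = (\<Sum>z\<in>{m..<d}. a z)"
      using that by (intro sum.mono_neutral_cong_right) auto
    also have "\<dots> = - (\<Sum>z\<in>{m..<d}. 1 / real (Suc z) - 1 / real z)"
      by (simp add: a_def flip: sum_negf)
    also have "\<dots> = 1 / real m - 1 / real d"
      using that by (subst sum_Suc_diff') auto
    finally show ?thesis by simp
  qed
  have "(\<Sum>i\<in>{1..d}. 1 / real (l i))
      = (\<Sum>i\<in>{1..d}. 1 / real d + (\<Sum>z\<in>{1..<d}. if l i \<le> z then a z else 0))"
    using l by (intro sum.cong refl inv) auto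
  also have "\<dots> = real d * (1 / real d) + (\<Sum>z\<in>{1..<d}. \<Sum>i\<in>{1..d}. if l i \<le> z then a z else 0)"
    by (subst sum.swap) (simp add: sum.distrib)
  also have "(\<Sum>z\<in>{1..<d}. \<Sum>i\<in>{1..d}. if l i \<le> z then a z else 0)
      = (\<Sum>z\<in>{1..<d}. real (card {i\<in>{1..d}. l i \<le> z}) * a z)"
    by (intro sum.cong refl) (simp flip: sum.inter_filter)
  also have "\<dots> \<le> (\<Sum>z\<in>{1..<d}. real z * a z)"
  proof (intro sum_mono mult_right_mono a0)
    fix z assume "z \<in> {1..<d}"
    then show "real (card {i\<in>{1..d}. l i \<le> z}) \<le> real z"
      using assms by (simp add: levels_def)
  qed auto
  also have "\<dots> = (\<Sum>z\<in>{1..<d}. 1 / real (Suc z))"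
  proof (intro sum.cong refl)
    fix z assume "z \<in> {1..<d}"
    then have "real z * a z = 1 - real z / real (Suc z)" by (simp add: a_def right_diff_distrib)
    then show "real z * a z = 1 / real (Suc z)" by (simp add: field_simps)
  qed
  \<comment> \<open>The first term supplies the summand \<open>1\<close> of \<open>harm d\<close>;
    for \<open>d = 0\<close> both sides vanish.\<close>
  also have "real d * (1 / real d) + \<dots> \<le> harm d"
  proof (cases d)
    case (Suc m)
    have "harm d = (1::real) + (\<Sum>z\<in>{2..d}. 1 / real z)"
      unfolding harm_def using Suc by (subst sum.atLeast_Suc_atMost) (auto simp: inverse_eq_divide numeral_2_eq_2)
    also have "(\<Sum>z\<in>{2..d}. 1 / real z) = (\<Sum>z\<in>{1..<d}. 1 / real (Suc z))"
      using Suc by (intro sum.reindex_bij_witness[of _ Suc "\<lambda>z. z - 1"]) auto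
    finally show ?thesis using Suc by simp
  qed (simp add: harm_def)
  finally show ?thesis by simp
qed

text \<open>Union bound over the level vectors; the exponents \<open>d / l i\<close> add up to at
  most \<open>d * harm d\<close>, and a factor \<open>2\<close> per coordinate absorbs rounding. As
  \<open>s\<close> enters the final bound with a negative exponent, the estimate from above is the
  relevant one.\<close>

lemma card_mesh_grid_le:
  assumes "mesh_indices c d n \<delta> Z" "1 \<le> \<delta>"
  shows "real (card (mesh_grid d n k Z)) \<le> real (card (levels d)) * 2 ^ d * real \<delta> powr (real d * harm d)"
proof -
  have Z: "Z i l \<subseteq> {1..n i}" "real (card (Z i l)) \<le> 2 * real \<delta> powr (real d / real l)"
    if "i \<in> {1..d}" "l \<in> {1..d}" for i l
  proof -
    show "Z i l \<subseteq> {1..n i}" using assms(1) that by (simp add: mesh_indices_def approx_equispaced_def)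
    have "\<bar>real (card (Z i l)) - real \<delta> powr (real d / real l)\<bar> < 1"
      using assms(1) that by (simp add: mesh_indices_def)
    moreover have "1 \<le> real \<delta> powr (real d / real l)"
      using assms(2) by (intro ge_one_powr_ge_zero) auto
    ultimately show "real (card (Z i l)) \<le> 2 * real \<delta> powr (real d / real l)" by linarith
  qed
  have fin: "finite (\<Pi>\<^sub>E i\<in>{1..d}. Z i (l i))" if "l \<in> levels d" for l
    using that by (intro finite_PiE finite_subset[OF Z(1)]) (auto simp: levels_def PiE_iff)
  have "card (mesh_grid d n k Z) \<le> card (\<Union>l\<in>levels d. \<Pi>\<^sub>E i\<in>{1..d}. Z i (l i))"
    unfolding mesh_grid_def by (intro card_mono finite_UN_I finite_levels fin) auto
  also have "\<dots> \<le> (\<Sum>l\<in>levels d. card (\<Pi>\<^sub>E i\<in>{1..d}. Z i (l i)))"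
    by (rule card_UN_le[OF finite_levels])
  finally have "real (card (mesh_grid d n k Z))
      \<le> real (\<Sum>l\<in>levels d. card (\<Pi>\<^sub>E i\<in>{1..d}. Z i (l i)))" by (rule of_nat_mono)
  also have "\<dots> = (\<Sum>l\<in>levels d. real (card (\<Pi>\<^sub>E i\<in>{1..d}. Z i (l i))))" by (rule of_nat_sum)
  also have "\<dots> \<le> (\<Sum>l\<in>levels d. 2 ^ d * real \<delta> powr (real d * harm d))"
  proof (rule sum_mono)
    fix l assume l: "l \<in> levels d"
    have "real (card (\<Pi>\<^sub>E i\<in>{1..d}. Z i (l i))) = (\<Prod>i\<in>{1..d}. real (card (Z i (l i))))"
      by (simp add: card_PiE)
    also have "\<dots> \<le> (\<Prod>i\<in>{1..d}. 2 * real \<delta> powr (real d / real (l i)))"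
      using l by (intro prod_mono conjI Z) (auto simp: levels_def PiE_iff)
    also have "\<dots> = 2 ^ d * real \<delta> powr (real d * (\<Sum>i\<in>{1..d}. 1 / real (l i)))"
      using assms(2) by (simp add: prod.distrib powr_sum sum_distrib_left)
    also have "\<dots> \<le> 2 ^ d * real \<delta> powr (real d * harm d)"
      using assms(2) by (intro mult_left_mono powr_mono sum_inverse_levels_le_harm l) auto
    finally show "real (card (\<Pi>\<^sub>E i\<in>{1..d}. Z i (l i))) \<le> 2 ^ d * real \<delta> powr (real d * harm d)" .
  qed
  finally show ?thesis by simp
qed

section \<open>Rate of the antiprojections and of the inverse scaling factor\<close>

text \<open>For order \<open>Suc k\<close> the exponent \<open>real k + 1 / 2\<close> is half of
  \<open>2 * Suc k - 1\<close>. The bound is uniform in \<open>j\<close>, as the maximum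
  requires.\<close>

lemma L2_set_antiproj_mesh_le:
  assumes "mesh_indices c d n \<delta> Z" "1 \<le> \<delta>" "j \<in> knot_box d n (Suc k)"
  shows "L2_set (antiproj (grid_box d n)
        (phit_tensor d n (Suc k) ` mesh_grid d n (Suc k) (enlarge (Suc k) Z))
        (phit_tensor d n (Suc k) j)) (grid_box d n)
    \<le> (2 * real (d + 1) * (2 * (\<bar>c\<bar> + real k + 1)) powr (real k + 1 / 2)) ^ d
      * real \<delta> powr (- (real d * (real k + 1 / 2))) * sqrt (real (\<Prod>i\<in>{1..d}. n i))"
proof -
  define K where "K = \<bar>c\<bar> + real k + 1"
  define r where "r = real k + 1 / 2"
  \<comment> \<open>Chosen so that \<open>\<eta> powr (1 / real l)\<close> has the order of
    \<open>card (Z i l) powr (- r)\<close>.\<close>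
  define \<eta> where "\<eta> = real \<delta> powr (- (real d * r))"
  \<comment> \<open>The factor \<open>2\<close> allows for rounding in \<open>card (Z i l)\<close>;
    as \<open>1 \<le> K\<close>, the same \<open>b i\<close> bounds the norm of the atom.\<close>
  define b where "b i = sqrt (real (n i)) * (2 * K) powr r" for i
  \<comment> \<open>Intersecting in every coordinate reproduces the intersection of the enlarged
    grid with \<open>knot_box\<close>.\<close>
  define Y where "Y i l = enlarge (Suc k) Z i l \<inter> {Suc (Suc k)..n i}" for i l
  define v where "v i = phit (n i) (Suc k) (j i)" for i
  let ?T = "mesh_grid d n (Suc k) (enlarge (Suc k) Z)"
  have j: "Suc (Suc k) \<le> j i" "j i \<le> n i" if "i \<in> {1..d}" for i
    using assms(3) that by (auto simp: knot_box_def PiE_iff)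
  have K: "1 \<le> K" by (simp add: K_def)
  have \<eta>: "0 < \<eta>" "\<eta> \<le> 1"
    using assms(2) powr_mono[of "- (real d * r)" 0 "real \<delta>"] by (auto simp: \<eta>_def r_def)
  have "\<exists>h. h \<in> fun_space.span (phit (n i) (Suc k) ` Y i l) \<and>
      L2_set (v i - h) {1..n i} \<le> b i * \<eta> powr (1 / real l)"
    if i: "i \<in> {1..d}" and l: "l \<in> {1..d}" for i l
  proof -
    have A: "approx_equispaced c (n i) (Z i l)" "\<bar>real (card (Z i l)) - real \<delta> powr (real d / real l)\<bar> < 1"
      using assms(1) i l by (auto simp: mesh_indices_def)
    then have "Z i l \<noteq> {}" "finite (Z i l)"
      by (auto simp: approx_equispaced_def intro: finite_subset)
    then have "1 \<le> real (card (Z i l))" by (simp add: Suc_le_eq card_gt_0_iff)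
    with A(2) have card: "real \<delta> powr (real d / real l) \<le> 2 * real (card (Z i l))" "0 < real (card (Z i l))"
      by linarith+
    have pos: "0 < real \<delta> powr (real d / real l)" using assms(2) by simp
    have "K / real (card (Z i l)) \<le> 2 * K / real \<delta> powr (real d / real l)"
    proof -
      have "K * real \<delta> powr (real d / real l) \<le> K * (2 * real (card (Z i l)))"
        using K card(1) by (intro mult_left_mono) auto
      then show ?thesis using card(2) pos by (simp add: divide_simps mult_ac)
    qed
    then have "(K / real (card (Z i l))) powr r \<le> (2 * K / real \<delta> powr (real d / real l)) powr r"
      using K card(2) by (intro powr_mono2) (auto simp: r_def)
    also have "\<dots> = (2 * K) powr r / real \<delta> powr (real d / real l * r)"
      using K by (simp add: powr_divide powr_powr)
    also have "\<dots> = (2 * K) powr r * real \<delta> powr (- (real d / real l * r))"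
      by (simp add: powr_minus_divide)
    also have "- (real d / real l * r) = - (real d * r) * (1 / real l)" by simp
    also have "real \<delta> powr \<dots> = \<eta> powr (1 / real l)"
      by (simp only: \<eta>_def powr_powr)
    finally have "sqrt (real (n i)) * (K / real (card (Z i l))) powr r \<le> b i * \<eta> powr (1 / real l)"
      by (simp add: b_def mult_left_mono mult.assoc)
    moreover obtain h where "h \<in> fun_space.span (phit (n i) (Suc k) ` Y i l)"
      "L2_set (v i - h) {1..n i} \<le> sqrt (real (n i)) * (K / real (card (Z i l))) powr r"
      using phit_approx[OF A(1) j[OF i]]
      unfolding Y_def enlarge_def v_def K_def r_def by blast
    ultimately show ?thesis by (meson order_trans)
  qed
  then have "\<forall>i\<in>{1..d}. \<forall>l\<in>{1..d}. \<exists>h. h \<in> fun_space.span (phit (n i) (Suc k) ` Y i l) \<and>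
      L2_set (v i - h) {1..n i} \<le> b i * \<eta> powr (1 / real l)" by blast
  then have "\<forall>i\<in>{1..d}. \<exists>p. \<forall>l\<in>{1..d}. p l \<in> fun_space.span (phit (n i) (Suc k) ` Y i l) \<and>
      L2_set (v i - p l) {1..n i} \<le> b i * \<eta> powr (1 / real l)"
    by (intro ballI bchoice) blast
  from bchoice[OF this]
  obtain P where P: "\<And>i l. i \<in> {1..d} \<Longrightarrow> l \<in> {1..d} \<Longrightarrow> P i l \<in> fun_space.span (phit (n i) (Suc k) ` Y i l)"
    "\<And>i l. i \<in> {1..d} \<Longrightarrow> l \<in> {1..d} \<Longrightarrow> L2_set (v i - P i l) {1..n i} \<le> b i * \<eta> powr (1 / real l)"
    by blast
  have nrm: "L2_set (v i) {1..n i} \<le> b i" if "i \<in> {1..d}" for i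
  proof -
    have "L2_set (v i) {1..n i} \<le> sqrt (real (j i - 1) ^ (2 * k + 1) / real (n i) ^ (2 * k))"
      unfolding v_def using j[OF that] by (intro L2_set_phit_le) auto
    also have "\<dots> \<le> sqrt (real (n i)) * (2 * K / 1) powr (real k + 1 / 2)"
    proof (rule sqrt_spline_bound)
      have "real (j i - 1) \<le> 1 * real (n i)" using j[OF that] by simp
      also have "\<dots> \<le> 2 * K * real (n i)" using K by (intro mult_right_mono) auto
      finally show "real (j i - 1) * 1 \<le> 2 * K * real (n i)" by simp
    qed (use j[OF that] in auto)
    finally show ?thesis by (simp add: b_def r_def)
  qed
  have nested: "Y i l' \<subseteq> Y i l" if "i \<in> {1..d}" "l \<in> {1..d}" "l' \<in> {1..d}" "l \<le> l'" for i l l'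
  proof -
    have "Z i l' \<subseteq> Z i l" using assms(1) that unfolding mesh_indices_def by blast
    then show ?thesis unfolding Y_def enlarge_def by blast
  qed
  have "\<exists>h\<in>fun_space.span ((\<lambda>j. tensor d n (\<lambda>i. phit (n i) (Suc k) (j i))) `
        (\<Union>l\<in>levels d. \<Pi>\<^sub>E i\<in>{1..d}. Y i (l i))).
    L2_set (tensor d n v - h) (grid_box d n) \<le> real (d + 1) ^ d * (2 ^ d * (\<Prod>i\<in>{1..d}. b i) * \<eta>)"
    by (rule tensor_levels_approx[OF \<eta> _ nested P nrm]) (simp_all add: Y_def)
  moreover have "(\<Union>l\<in>levels d. \<Pi>\<^sub>E i\<in>{1..d}. Y i (l i)) = ?T"
  proof -
    have "(\<Pi>\<^sub>E i\<in>{1..d}. Y i (l i)) = (\<Pi>\<^sub>E i\<in>{1..d}. enlarge (Suc k) Z i (l i)) \<inter> knot_box d n (Suc k)" for l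
      by (auto simp: Y_def knot_box_def PiE_iff)
    then show ?thesis unfolding mesh_grid_def by auto
  qed
  ultimately obtain h where h: "h \<in> fun_space.span (phit_tensor d n (Suc k) ` ?T)"
    "L2_set (phit_tensor d n (Suc k) j - h) (grid_box d n)
      \<le> real (d + 1) ^ d * (2 ^ d * (\<Prod>i\<in>{1..d}. b i) * \<eta>)"
    unfolding v_def phit_tensor_eq_tensor[symmetric] by auto
  have "finite ?T"
    unfolding mesh_grid_def knot_box_def by (intro finite_Int disjI2 finite_PiE) auto
  then have "L2_set (antiproj (grid_box d n) (phit_tensor d n (Suc k) ` ?T) (phit_tensor d n (Suc k) j))
      (grid_box d n) \<le> L2_set (phit_tensor d n (Suc k) j - h) (grid_box d n)"
    using h(1) by (intro L2_set_antiproj_le finite_grid_box) (auto simp: phit_tensor_def)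
  also note h(2)
  also have "(\<Prod>i\<in>{1..d}. b i) = sqrt (real (\<Prod>i\<in>{1..d}. n i)) * ((2 * K) powr r) ^ d"
    by (simp add: b_def prod.distrib sqrt_prod)
  also have "real (d + 1) ^ d * (2 ^ d * (sqrt (real (\<Prod>i\<in>{1..d}. n i)) * ((2 * K) powr r) ^ d) * \<eta>)
      = (2 * real (d + 1) * (2 * K) powr r) ^ d * \<eta> * sqrt (real (\<Prod>i\<in>{1..d}. n i))"
    by (simp only: power_mult_distrib mult_ac)
  finally show ?thesis by (simp only: \<eta>_def K_def r_def)
qed

theorem lemma6p3:
  fixes d k :: nat and c\<^sub>1 c\<^sub>2 :: real
  assumes "d \<ge> 1" and "k \<ge> 1"
  shows "\<exists>C>0. \<forall>(n :: nat \<Rightarrow> nat) (\<delta> :: nat) (Z :: nat \<Rightarrow> nat \<Rightarrow> nat set) (s :: nat).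
      (\<forall>i\<in>{1..d}. k + 1 \<le> n i) \<longrightarrow>
      comparable_sizes c\<^sub>1 d n \<longrightarrow>
      \<delta> \<ge> 1 \<longrightarrow>
      mesh_indices c\<^sub>2 d n \<delta> Z \<longrightarrow>
      s = card (mesh_grid d n k Z) \<longrightarrow>
      s \<ge> 1 \<longrightarrow>
      inv_scaling d n k (mesh_grid d n k (enlarge k Z))
        \<le> C * real s powr (- ((2 * real k - 1) / (2 * harm d)))"
proof -
  obtain m where k: "k = Suc m" using assms(2) by (cases k) auto
  define r where "r = real m + 1 / 2"
  define H where "H = (harm d :: real)"
  define B where "B = (2 * real (d + 1) * (2 * (\<bar>c\<^sub>2\<bar> + real m + 1)) powr r) ^ d"
  define L where "L = (real (card (levels d)) + 1) * 2 ^ d"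
  have H: "0 < H" unfolding H_def using assms(1) by (intro harm_pos) auto
  have B: "0 < B" by (simp add: B_def)
  have L: "0 < L" by (simp add: L_def)
  have r: "(2 * real k - 1) / (2 * H) = r / H" by (simp add: r_def k field_simps)
  have r0: "0 < r" by (simp add: r_def)
  show ?thesis
  \<comment> \<open>\<open>B\<close> is the constant of the bound in \<delta>, and the power of
    \<open>L\<close> arises when \<delta> is replaced by \<open>s\<close>.\<close>
  proof (intro exI[of _ "B * L powr (r / H)"] conjI allI impI)
    show "0 < B * L powr (r / H)" using B L by simp
    fix n \<delta> Z s
    assume n: "\<forall>i\<in>{1..d}. k + 1 \<le> n i" and \<delta>: "1 \<le> \<delta>"
      and Z: "mesh_indices c\<^sub>2 d n \<delta> Z" and s: "s = card (mesh_grid d n k Z)" "1 \<le> s"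
    let ?T = "mesh_grid d n k (enlarge k Z)" and ?\<eta> = "real \<delta> powr (- (real d * r))"
    let ?N = "sqrt (real (\<Prod>i\<in>{1..d}. n i))"
    have N: "0 < ?N" using n by (auto simp: Suc_le_eq intro!: prod_pos)
    have "real s \<le> L * real \<delta> powr (real d * H)"
    proof -
      have "real s \<le> real (card (levels d)) * 2 ^ d * real \<delta> powr (real d * H)"
        unfolding s(1) H_def by (rule card_mesh_grid_le[OF Z \<delta>])
      also have "\<dots> \<le> L * real \<delta> powr (real d * H)"
        unfolding L_def by (intro mult_right_mono) auto
      finally show ?thesis .
    qed
    \<comment> \<open>The negative exponent reverses the inequality and turns
      \<open>\<delta> powr (d * H)\<close> into \<open>\<delta> powr (- (d * r))\<close>.\<close>
    then have "(L * real \<delta> powr (real d * H)) powr (- (r / H)) \<le> real s powr (- (r / H))"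
      using s(2) r0 H by (intro powr_mono2') auto
    also have "(L * real \<delta> powr (real d * H)) powr (- (r / H)) = L powr (- (r / H)) * ?\<eta>"
      using L H by (simp add: powr_mult powr_powr)
    finally have "L powr (r / H) * (L powr (- (r / H)) * ?\<eta>) \<le> L powr (r / H) * real s powr (- (r / H))"
      by (intro mult_left_mono) auto
    then have \<eta>_le: "?\<eta> \<le> L powr (r / H) * real s powr (- (r / H))"
      using L by (simp add: mult.assoc[symmetric] powr_minus)
    have "inv_scaling d n k ?T \<le> B * ?\<eta>"
      unfolding inv_scaling_def
    proof (subst Max_le_iff)
      show "finite ((\<lambda>j. L2_set (antiproj (grid_box d n) (phit_tensor d n k ` ?T) (phit_tensor d n k j))
                 (grid_box d n) / ?N) ` knot_box d n k)"
        unfolding knot_box_def by (intro finite_imageI finite_PiE) auto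
      show "(\<lambda>j. L2_set (antiproj (grid_box d n) (phit_tensor d n k ` ?T) (phit_tensor d n k j))
                 (grid_box d n) / ?N) ` knot_box d n k \<noteq> {}"
        using n by (auto simp: knot_box_def PiE_eq_empty_iff)
      show "\<forall>a\<in>(\<lambda>j. L2_set (antiproj (grid_box d n) (phit_tensor d n k ` ?T) (phit_tensor d n k j))
                 (grid_box d n) / ?N) ` knot_box d n k. a \<le> B * ?\<eta>"
      proof (rule ballI, elim imageE, simp only:)
        fix j assume "j \<in> knot_box d n k"
        then have "L2_set (antiproj (grid_box d n) (phit_tensor d n k ` ?T) (phit_tensor d n k j))
                 (grid_box d n) \<le> B * ?\<eta> * ?N"
          using L2_set_antiproj_mesh_le[OF Z \<delta>, of j m] by (simp only: k B_def r_def)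
        then show "L2_set (antiproj (grid_box d n) (phit_tensor d n k ` ?T) (phit_tensor d n k j))
                 (grid_box d n) / ?N \<le> B * ?\<eta>"
          using N by (simp only: pos_divide_le_eq)
      qed
    qed
    also have "\<dots> \<le> B * (L powr (r / H) * real s powr (- (r / H)))"
      using \<eta>_le B by (intro mult_left_mono) auto
    finally show "inv_scaling d n k ?T
        \<le> B * L powr (r / H) * real s powr (- ((2 * real k - 1) / (2 * harm d)))"
      using r by (simp add: H_def mult.assoc)
  qed
qed

end
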